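(* Let $q$ be a prime power, let $n$ and $m\ge3$ be positive integers, and let $I,J$ be nonnegative integers with $I<J<n$; put $K:=J-I$ and $C_{h,\ell}:=\frac{q^{h\ell}-1}{q^h-1}$. Let $\alpha_1,\dots,\alpha_m\in\mathbb{F}_{q^n}^*$, $\mathbf{A}=(\alpha_1,\dots,\alpha_m)$. For $i\in\{1,\dots,m\}$ let $\Pi_i:=\prod_{j=0}^{m-1}\alpha_{i-j}^{q^{(m-1-j)K}}$ (indices modulo $m$ in $\{1,\dots,m\}$), and let $$K^{I,J}_{\mathbf{A}}:=\frac{\alpha_3\,\alpha_4^{q^K}\cdots\alpha_m^{q^{(m-3)K}}\,\alpha_1^{q^{(m-2)K}}}{\alpha_2^{C_{K,m-1}}}.$$ Assume $\gcd(I,J)=1$, $K^{I,J}_{\mathbf{A}}$ is not a $C_{K,m}$-power in $\mathbb{F}_{q^n}$, and $\Pi_{\delta+2}/\Pi_2$ is not a $(q^{mK}-1)$-power in $\mathbb{F}_{q^n}$ for any $\delta=1,\dots,m-1$. Then there are infinitely many positive integers $\ell$ such that $$U^{I,J}_{\mathbf{A},\ell}:=\{(x_1,\dots,x_m,f_1(\underline{x}),\dots,f_m(\underline{x})) : x_1,\dots,x_m\in\mathbb{F}_{q^{n\ell}}\}\subseteq\mathbb{F}_{q^{n\ell}}^{2m}$$ is scattered and indecomposable, where $f_i(\underline{x})=x_i^{q^I}+\alpha_{i+1}x_{i+1}^{q^J}$ ($i=1,\dots,m-1$) and $f_m(\underline{x})=x_m^{q^I}+\alpha_1x_1^{q^J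}$.
   Context: An element $a$ of a field $F$ is a $d$-power in $F$ if $a=y^d$ for some $y\in F$. An $\mathbb{F}_q$-subspace $U$ of $\mathbb{F}_{Q}^k$ ($Q$ a power of $q$) is scattered if $\dim_{\mathbb{F}_q}(U\cap\langle v\rangle_{\mathbb{F}_{Q}})\le1$ for all $v\in\mathbb{F}_Q^k$. It is decomposable if there are nonzero $\mathbb{F}_{Q}$-subspaces $W_1,W_2$ with $\mathbb{F}_{Q}^k=W_1\oplus W_2$ such that $U=(U\cap W_1)\oplus(U\cap W_2)$ with both intersections nonzero; indecomposable otherwise.
   Formalization: The formal theorem assumes I ≥ 1 instead of I ≥ 0: for I = 0 (so J = 1) the set U is always decomposable, and the hypotheses can hold, e.g. q=2, n=m=3, α=(g,1,1) with g a generator of F_8^*, so the claim fails there. *)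

theory Defs
  imports "Jordan_Normal_Form.VS_Connect"
begin

text \<open>
  All finite fields live in one algebraically closed field of characteristic \<open>p\<close>:
  for a power \<open>Q\<close> of \<open>p\<close>, the field with \<open>Q\<close> elements consists of the roots
  of \<open>X ^ Q - X\<close>; see \<open>field_GF\<close> and \<open>card_GF\<close> below.
\<close>

definition GF :: "nat \<Rightarrow> 'a :: field ring" where
  "GF Q = \<lparr>carrier = {x. x ^ Q = x}, mult = (*), one = 1, zero = 0, add = (+)\<rparr>"

text \<open>
  The scalar multiplication of \<open>GF_vec Q k\<close> accepts all scalars of the ambient field,
  so the same record serves as a vector space over \<open>GF Q\<close> and, by restriction
  of scalars, over each subfield \<open>GF q\<close>; see \<open>vectorspace_GF_vec\<close> below.
\<close>

definition GF_vec :: "nat \<Rightarrow> nat \<Rightarrow> ('a :: field, 'a vec) module" where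
  "GF_vec Q k = (module_vec TYPE('a) k)
     \<lparr>carrier := {v \<in> carrier_vec k. \<forall>i<k. v $ i \<in> carrier (GF Q)}\<rparr>"

definition is_power_in :: "nat \<Rightarrow> 'a :: monoid_mult set \<Rightarrow> 'a \<Rightarrow> bool" where
  "is_power_in d F a \<longleftrightarrow> (\<exists>y\<in>F. a = y ^ d)"

definition is_direct_sum :: "('a, 'b, 'd) module_scheme \<Rightarrow> 'b set \<Rightarrow> 'b set \<Rightarrow> 'b set \<Rightarrow> bool" where
  "is_direct_sum V W W1 W2 \<longleftrightarrow>
     W = LinearCombinations.module.submodule_sum V W1 W2 \<and> W1 \<inter> W2 = {\<zero>\<^bsub>V\<^esub>}"

definition scattered ::
    "('a, 'c) ring_scheme \<Rightarrow> ('a, 'e) ring_scheme \<Rightarrow> ('a, 'b, 'd) module_scheme \<Rightarrow> 'b set \<Rightarrow> bool" where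
  "scattered F E V U \<longleftrightarrow> subspace F U V \<and>
     (\<forall>v\<in>carrier V.
        vectorspace.dim F (V\<lparr>carrier := U \<inter> LinearCombinations.module.span E V {v}\<rparr>) \<le> 1)"

definition decomposable ::
    "('a, 'e) ring_scheme \<Rightarrow> ('a, 'b, 'd) module_scheme \<Rightarrow> 'b set \<Rightarrow> bool" where
  "decomposable E V U \<longleftrightarrow>
     (\<exists>W1 W2. subspace E W1 V \<and> subspace E W2 V \<and> W1 \<noteq> {\<zero>\<^bsub>V\<^esub>} \<and> W2 \<noteq> {\<zero>\<^bsub>V\<^esub>} \<and>
        is_direct_sum V (carrier V) W1 W2 \<and>
        is_direct_sum V U (U \<inter> W1) (U \<inter> W2) \<and>
        U \<inter> W1 \<noteq> {\<zero>\<^bsub>V\<^esub>} \<and> U \<inter> W2 \<noteq> {\<zero>\<^bsub>V\<^esub>})"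

abbreviation indecomposable ::
    "('a, 'e) ring_scheme \<Rightarrow> ('a, 'b, 'd) module_scheme \<Rightarrow> 'b set \<Rightarrow> bool" where
  "indecomposable E V U \<equiv> \<not> decomposable E V U"

text \<open>The representative of \<open>i\<close> modulo \<open>m\<close> in \<open>{1..m}\<close>.\<close>

definition cyc :: "nat \<Rightarrow> int \<Rightarrow> nat" where
  "cyc m i = nat ((i - 1) mod int m) + 1"

text \<open>For \<open>q \<ge> 2\<close> and \<open>h \<ge> 1\<close> the division is exact.\<close>

definition C_num :: "nat \<Rightarrow> nat \<Rightarrow> nat \<Rightarrow> nat" where
  "C_num q h l = (q ^ (h * l) - 1) div (q ^ h - 1)"

definition Pi_prod :: "nat \<Rightarrow> nat \<Rightarrow> nat \<Rightarrow> (nat \<Rightarrow> 'a :: field) \<Rightarrow> int \<Rightarrow> 'a" where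
  "Pi_prod q m K \<alpha> i = (\<Prod>j = 0..m - 1. \<alpha> (cyc m (i - int j)) ^ (q ^ ((m - 1 - j) * K)))"

definition K_const :: "nat \<Rightarrow> nat \<Rightarrow> nat \<Rightarrow> (nat \<Rightarrow> 'a :: field) \<Rightarrow> 'a" where
  "K_const q m K \<alpha> =
     ((\<Prod>i = 3..m. \<alpha> i ^ (q ^ ((i - 3) * K))) * \<alpha> 1 ^ (q ^ ((m - 2) * K))) / \<alpha> 2 ^ C_num q K (m - 1)"

definition f_poly ::
    "nat \<Rightarrow> nat \<Rightarrow> nat \<Rightarrow> nat \<Rightarrow> (nat \<Rightarrow> 'a :: field) \<Rightarrow> nat \<Rightarrow> (nat \<Rightarrow> 'a) \<Rightarrow> 'a" where
  "f_poly q m I J \<alpha> i x =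
     (if i < m then x i ^ (q ^ I) + \<alpha> (i + 1) * x (i + 1) ^ (q ^ J)
      else x m ^ (q ^ I) + \<alpha> 1 * x 1 ^ (q ^ J))"

text \<open>
  Families are indexed from \<open>1\<close>, entries of vectors from \<open>0\<close>.
\<close>

definition U_set :: "nat \<Rightarrow> nat \<Rightarrow> nat \<Rightarrow> nat \<Rightarrow> nat \<Rightarrow> (nat \<Rightarrow> 'a :: field) \<Rightarrow> 'a vec set" where
  "U_set q Q m I J \<alpha> =
     {vec (2 * m) (\<lambda>i. if i < m then x (i + 1) else f_poly q m I J \<alpha> (i - m + 1) x) | x.
        \<forall>i\<in>{1..m}. x i \<in> carrier (GF Q)}"

lemma carrier_GF_iff: "x \<in> carrier (GF Q) \<longleftrightarrow> x ^ Q = x"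
  by (simp add: GF_def)

context
  fixes Q r :: nat
  assumes char: "prime CHAR('a :: field)" and Q: "Q = CHAR('a) ^ r"
begin

private lemma Q_pos: "0 < Q"
  using char Q by (simp add: prime_gt_0_nat)

private lemma add_pow: "((x :: 'a) + y) ^ Q = x ^ Q + y ^ Q"
  using freshmans_dream'[OF char] Q by metis

private lemma uminus_pow: "(- (x :: 'a)) ^ Q = - (x ^ Q)"
proof -
  have "(x + (- x)) ^ Q = x ^ Q + (- x) ^ Q" by (rule add_pow)
  then have "x ^ Q + (- x) ^ Q = 0" using Q_pos by (simp add: zero_power)
  then show ?thesis by (metis add_eq_0_iff)
qed

lemma field_GF: "field (GF Q :: 'a ring)"
proof -
  have inv: "\<exists>y. y ^ Q = y \<and> x * y = 1" if "x ^ Q = x" "x \<noteq> 0" for x :: 'a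
    using that by (intro exI[of _ "inverse x"]) (simp add: power_inverse)
  have neg: "\<exists>y. y ^ Q = y \<and> x + y = 0" if "x ^ Q = x" for x :: 'a
    using that by (intro exI[of _ "- x"]) (simp add: uminus_pow)
  interpret cring "GF Q :: 'a ring"
    by (rule cringI, rule abelian_groupI)
      (auto simp: GF_def add_pow Q_pos zero_power power_mult_distrib algebra_simps
         intro!: comm_monoidI neg)
  show ?thesis
    by (rule cring_fieldI2) (use inv in \<open>auto simp: GF_def\<close>)
qed

lemma GF_mono:
  assumes "(x :: 'a) \<in> carrier (GF Q)"
  shows "x \<in> carrier (GF (Q ^ s))"
  using assms by (induction s) (simp_all add: carrier_GF_iff power_mult mult.commute)

end

lemma vectorspace_GF_vec:
  assumes char: "prime CHAR('a :: field)" and Q: "Q = CHAR('a) ^ r"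
  shows "vectorspace (GF Q :: 'a ring) (GF_vec (Q ^ s) k)"
proof -
  interpret F: field "GF Q :: 'a ring" by (rule field_GF[OF char Q])
  have Qs: "Q ^ s = CHAR('a) ^ (r * s)" by (simp add: Q power_mult)
  interpret E: field "GF (Q ^ s) :: 'a ring" by (rule field_GF[OF char Qs])
  have zero: "(0 :: 'a) \<in> carrier (GF (Q ^ s))"
    using E.zero_closed by (simp add: GF_def)
  have add: "x + y \<in> carrier (GF (Q ^ s))"
    if "x \<in> carrier (GF (Q ^ s))" "y \<in> carrier (GF (Q ^ s))" for x y :: 'a
    using E.a_closed[of x y] that by (simp add: GF_def)
  have mult: "x * y \<in> carrier (GF (Q ^ s))"
    if "x \<in> carrier (GF (Q ^ s))" "y \<in> carrier (GF (Q ^ s))" for x y :: 'a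
    using E.m_closed[of x y] that by (simp add: GF_def)
  have neg: "- x \<in> carrier (GF (Q ^ s))" if "x \<in> carrier (GF (Q ^ s))" for x :: 'a
  proof -
    have "- 1 * x \<in> carrier (GF (Q ^ s))"
    proof (rule mult[OF _ that])
      obtain y :: 'a where "y \<in> carrier (GF (Q ^ s))" "y + 1 = 0"
        using E.l_neg[OF E.one_closed] E.a_inv_closed[OF E.one_closed] by (auto simp: GF_def)
      then show "(- 1 :: 'a) \<in> carrier (GF (Q ^ s))"
        by (metis eq_neg_iff_add_eq_0)
    qed
    then show ?thesis by simp
  qed
  have group: "abelian_group (GF_vec (Q ^ s) k :: ('a, 'a vec) module)"
  proof (rule abelian_groupI, goal_cases)
    case (6 x)
    then show ?case
      by (intro bexI[of _ "- x"]) (auto simp: GF_vec_def module_vec_simps neg)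
  qed (auto simp: GF_vec_def module_vec_simps add zero)
  have "Module.module (GF Q :: 'a ring) (GF_vec (Q ^ s) k)"
  proof (rule Module.module.intro[OF F.is_cring group], unfold_locales, goal_cases)
    case (1 a x)
    then show ?case
      using GF_mono[OF char Q] by (auto simp: GF_vec_def module_vec_simps intro!: mult)
  qed (auto simp: GF_vec_def module_vec_simps GF_def
         add_smult_distrib_vec smult_add_distrib_vec smult_smult_assoc)
  then show ?thesis
    by (intro vectorspace.intro F.field_axioms)
qed

lemma card_GF:
  assumes char: "prime CHAR('a :: alg_closed_field)" and Q: "Q = CHAR('a) ^ r" and r: "0 < r"
  shows "card (carrier (GF Q :: 'a ring)) = Q"
proof -
  define P :: "'a poly" where "P = monom 1 Q - monom 1 1"
  have Q1: "1 < Q"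
    using char r unfolding Q by (intro one_less_power prime_gt_1_nat)
  have deg: "degree P = Q"
    unfolding P_def diff_conv_add_uminus using Q1
    by (subst degree_add_eq_left) (simp_all add: degree_monom_eq)
  have P0: "P \<noteq> 0" using deg Q1 by auto
  have root: "poly P x = 0 \<longleftrightarrow> x \<in> carrier (GF Q)" for x
    by (simp add: P_def poly_monom carrier_GF_iff)
  have "of_nat Q = (0 :: 'a)"
    unfolding Q using r by (simp add: of_nat_power zero_power)
  then have pd: "pderiv P = - 1"
    by (simp add: P_def pderiv_diff pderiv_monom monom_0 one_pCons)
  obtain A where A: "size A = degree P" "P = Polynomial.smult (lead_coeff P) (\<Prod>x\<in>#A. [:- x, 1:])"
    using alg_closed_imp_factorization[OF P0] by blast
  have count: "count A x \<le> 1" for x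
  proof (rule ccontr)
    assume "\<not> count A x \<le> 1"
    then have "{#x, x#} \<subseteq># A" by (auto simp: subseteq_mset_def)
    then obtain B where "A = {#x, x#} + B" by (metis subset_mset.le_iff_add)
    then have "[:- x, 1:] * [:- x, 1:] dvd P"
      by (subst A(2)) (simp add: mult.assoc[symmetric] dvd_smult del: mult_pCons_left mult_pCons_right)
    then obtain R where "P = [:- x, 1:] * ([:- x, 1:] * R)"
      unfolding dvd_def by (metis mult.assoc)
    then have "poly (pderiv P) x = 0"
      by (simp add: pderiv_mult del: mult_pCons_left mult_pCons_right)
    then show False by (simp add: pd)
  qed
  have "set_mset A = carrier (GF Q)"
  proof -
    have "poly P x = 0 \<longleftrightarrow> x \<in># A" for x
      using P0 by (subst A(2)) (auto simp: poly_prod_mset prod_mset_zero_iff)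
    then show ?thesis using root by auto
  qed
  moreover have "size A = card (set_mset A)"
  proof -
    have "count A x = 1" if "x \<in># A" for x
      using count[of x] that by (metis One_nat_def count_greater_zero_iff le_antisym Suc_leI)
    then show ?thesis by (simp add: size_multiset_overloaded_eq)
  qed
  ultimately show ?thesis using A(1) deg by simp
qed

end

theory Submission
  imports Defs
begin

text \<open>
  If \<open>l\<close> is coprime to \<open>d\<close>, taking norms shows that an element of \<open>GF (q ^ n)\<close> which is a
  \<open>d\<close>-power in \<open>GF (q ^ (n * l))\<close> is already one in \<open>GF (q ^ n)\<close>. Hence the two non-power
  hypotheses persist for all \<open>l \<equiv> 1\<close> modulo \<open>q ^ (m * K) - 1\<close>.

  If \<open>(x, f x)\<close> and \<open>c (x, f x)\<close> both lie in \<open>U\<close> with \<open>c\<close> outside \<open>GF q\<close>, then the entries of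
  \<open>x\<close> satisfy a cyclic recursion; going once around it exhibits the constant \<open>K_const\<close> as
  a \<open>C_num q K m\<close>-power unless \<open>x = 0\<close>.

  A decomposition of \<open>U\<close> gives a projection with blocks \<open>A, B, C, D\<close> that maps \<open>U\<close> to itself.
  For \<open>2 J < n l\<close> this is an identity of linearized polynomials, and comparing coefficients gives
  \<open>B = C = 0\<close>, \<open>D = A ^ (q ^ I)\<close> entrywise, and a recursion along each cyclic diagonal of \<open>D\<close>. An
  off-diagonal entry that does not vanish would make some \<open>\<Pi>\<^bsub>\<delta>+2\<^esub> / \<Pi>\<^bsub>2\<^esub>\<close> a \<open>(q ^ (m * K) - 1)\<close>-power;
  so the projection is diagonal, its diagonal is constant, and it is \<open>0\<close> or the identity.
\<close>

subsection \<open>Powers in finite fields\<close>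

lemma power_eq_iterate:
  fixes x :: "'a :: monoid_mult"
  assumes "x ^ Q = x"
  shows "x ^ (Q ^ k) = x"
proof (induction k)
  case (Suc k)
  have "x ^ (Q ^ Suc k) = (x ^ Q) ^ (Q ^ k)" by (simp add: power_mult)
  then show ?case using Suc assms by simp
qed simp

text \<open>The norm \<open>w\<close> of \<open>y\<close> down to \<open>GF Q\<close> satisfies
  \<open>w ^ d = a ^ l\<close>. A Bezout relation \<open>l * u = d * v + 1\<close> then extracts
  \<open>a\<close> itself as the \<open>d\<close>-th power of \<open>w ^ u / a ^ v\<close>.\<close>

lemma GF_power_descent:
  fixes a :: "'a :: field"
  assumes a: "a \<in> carrier (GF Q)" "a \<noteq> 0" and "0 < l" and cop: "coprime l d"
    and pow: "is_power_in d (carrier (GF (Q ^ l))) a"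
  shows "is_power_in d (carrier (GF Q)) a"
proof -
  obtain y where y: "y ^ (Q ^ l) = y" "a = y ^ d"
    using pow by (auto simp: is_power_in_def carrier_GF_iff)
  obtain k where k: "l = Suc k" using \<open>0 < l\<close> gr0_implies_Suc by blast
  \<comment> \<open>the norm of \<open>y\<close>, so that \<open>w ^ d\<close> is the norm \<open>a ^ l\<close> of \<open>a\<close>\<close>
  define w where "w = (\<Prod>i<l. y ^ (Q ^ i))"
  \<comment> \<open>Frobenius moves each conjugate of \<open>y\<close> to the next one; the last
    wraps around to the first because \<open>y ^ (Q ^ l) = y\<close>.\<close>
  have "w ^ Q = (\<Prod>i<l. y ^ (Q ^ Suc i))"
    by (simp add: w_def prod_power_distrib power_mult[symmetric] mult.commute)
  also have "\<dots> = (\<Prod>i<k. y ^ (Q ^ Suc i)) * y ^ (Q ^ l)"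
    by (simp add: k)
  also have "\<dots> = w"
    unfolding y(1) unfolding w_def k prod.lessThan_Suc_shift by simp
  finally have wQ: "w ^ Q = w" .
  have "w ^ d = (\<Prod>i<l. (y ^ d) ^ (Q ^ i))"
    by (simp add: w_def prod_power_distrib power_mult[symmetric] mult.commute)
  also have "\<dots> = (\<Prod>i<l. a)"
    using a by (simp add: y(2)[symmetric] power_eq_iterate carrier_GF_iff)
  finally have wd: "w ^ d = a ^ l" by simp
  obtain u v where uv: "l * u = d * v + 1"
    using bezout_nat[of l d] \<open>0 < l\<close> cop by auto
  have "a ^ (d * v) * a = a ^ (l * u)" by (simp add: uv)
  also have "\<dots> = (w ^ u) ^ d"
    by (metis wd mult.commute power_mult)
  finally have "a = (w ^ u / a ^ v) ^ d"
    using a(2) by (simp add: field_simps power_divide power_mult[symmetric])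
  moreover have "(w ^ u / a ^ v) ^ Q = w ^ u / a ^ v"
    using wQ a(1) by (simp add: power_divide carrier_GF_iff) (metis mult.commute power_mult)
  ultimately show ?thesis unfolding is_power_in_def
    by (intro bexI[of _ "w ^ u / a ^ v"]) (simp_all add: carrier_GF_iff)
qed

text \<open>For a sequence with \<open>z k = z 0 \<noteq> 0\<close> this exhibits the inverse of the
  coefficient product as the power of \<open>z 0\<close> with exponent \<open>N ^ k - 1\<close>.
  Both non-power hypotheses are contradicted in this way.\<close>

lemma power_recursion_unroll:
  fixes z c :: "nat \<Rightarrow> 'a :: comm_monoid_mult"
  assumes "\<And>k. z k = c k * z (Suc k) ^ N"
  shows "z 0 = (\<Prod>j<k. c j ^ (N ^ j)) * z k ^ (N ^ k)"
proof (induction k)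
  case (Suc k)
  have "z k ^ (N ^ k) = c k ^ (N ^ k) * z (Suc k) ^ (N ^ Suc k)"
    by (subst assms) (simp add: power_mult_distrib power_mult)
  then show ?case using Suc by (simp add: mult.assoc)
qed simp

text \<open>Used in contraposed form: one nonzero term of the recursion makes \<open>z 0\<close>
  nonzero, so that \<open>z 0\<close> can be cancelled.\<close>

lemma power_recursion_eq_0:
  fixes z c :: "nat \<Rightarrow> 'a :: field"
  assumes "\<And>k. z k = c k * z (Suc k) ^ N" "\<And>k. c k \<noteq> 0" "z 0 = 0"
  shows "z k = 0"
proof (induction k)
  case (Suc k)
  then have "c k * z (Suc k) ^ N = 0" using assms(1)[of k] by simp
  then show ?case using assms(2)[of k] by simp
qed (fact assms(3))

text \<open>By \<open>I * u = J * v + 1\<close>, a power of the \<open>q ^ I\<close>-Frobenius is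
  the \<open>q\<close>-Frobenius composed with a power of the \<open>q ^ J\<close>-Frobenius, and
  both outer maps fix \<open>x\<close>.\<close>

lemma GF_eq_of_coprime:
  fixes x :: "'a :: field"
  assumes "0 < I" "gcd I J = 1" "x \<in> carrier (GF (q ^ I))" "x \<in> carrier (GF (q ^ J))"
  shows "x \<in> carrier (GF q)"
proof -
  obtain u v where uv: "I * u = J * v + 1"
    using bezout_nat[of I J] assms(1,2) by auto
  have "x = x ^ ((q ^ I) ^ u)"
    using assms(3) by (simp add: carrier_GF_iff power_eq_iterate)
  also have "(q ^ I) ^ u = (q ^ J) ^ v * q"
    by (metis power_add power_mult power_one_right uv)
  also have "x ^ ((q ^ J) ^ v * q) = x ^ q"
    using assms(4) by (simp add: carrier_GF_iff power_eq_iterate power_mult)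
  finally show ?thesis by (simp add: carrier_GF_iff)
qed

subsection \<open>Cyclic products\<close>

lemma cyc_in: "0 < m \<Longrightarrow> cyc m i \<in> {1..m}"
  by (simp add: cyc_def Suc_le_eq nat_less_iff)

lemma cyc_eq: "i \<in> {1..m} \<Longrightarrow> cyc m (int i) = i"
  by (auto simp: cyc_def)

lemma cyc_add_modulus: "cyc m (i + int m) = cyc m i"
proof -
  have "i + int m - 1 = i - 1 + int m" by simp
  then show ?thesis unfolding cyc_def by (simp only: mod_add_self2)
qed

lemma cyc_cong: "0 < m \<Longrightarrow> cyc m i = cyc m j \<longleftrightarrow> i mod int m = j mod int m"
proof -
  assume "0 < m"
  then have "cyc m i = cyc m j \<longleftrightarrow> (i - 1) mod int m = (j - 1) mod int m"
    by (simp add: cyc_def nat_eq_iff)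
  also have "\<dots> \<longleftrightarrow> i mod int m = j mod int m"
    using mod_diff_cong[of i "int m" j 1 1] mod_add_cong[of "i - 1" "int m" "j - 1" 1 1] by auto
  finally show ?thesis .
qed

lemma int_cyc: "0 < m \<Longrightarrow> int (cyc m i) mod int m = i mod int m"
  using cyc_cong[of m "int (cyc m i)" i] cyc_eq[OF cyc_in] by simp

lemma cyc_add_cyc: "0 < m \<Longrightarrow> cyc m (int (cyc m i) + j) = cyc m (i + j)"
  by (simp add: cyc_cong) (rule mod_add_cong[OF int_cyc refl])

lemma geometric_sum_nat: "(N - 1) * (\<Sum>j<m. N ^ j) = N ^ m - (1 :: nat)"
proof (cases N)
  case (Suc a)
  have "a * (\<Sum>j<m. Suc a ^ j) + 1 = Suc a ^ m"
    by (induction m) (simp_all add: algebra_simps)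
  then show ?thesis using Suc by (metis add_diff_cancel_right' diff_Suc_1)
qed (cases m, auto)

lemma cyc_succ_cyc: "0 < m \<Longrightarrow> cyc m (int (cyc m i) + 1) = cyc m (i + 1)"
  by (rule cyc_add_cyc)

lemma cyc_pred_cyc: "0 < m \<Longrightarrow> cyc m (int (cyc m i) - 1) = cyc m (i - 1)"
  using cyc_add_cyc[of m i "- 1"] by simp

lemma C_num_eq_sum:
  assumes "2 \<le> q" "0 < K"
  shows "C_num q K m = (\<Sum>j<m. (q ^ K) ^ j)"
proof -
  have N: "1 < q ^ K" using assms by (intro one_less_power) auto
  have "(q ^ K - 1) * (\<Sum>j<m. (q ^ K) ^ j) = (q ^ K) ^ m - 1"
    by (rule geometric_sum_nat)
  then show ?thesis using N unfolding C_num_def power_mult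
    by (metis nonzero_mult_div_cancel_left zero_less_diff less_numeral_extra(3))
qed

text \<open>Reversing the order of the factors brings \<open>Pi_prod\<close> into the shape that
  unrolling a cyclic recursion produces: indices rise from \<open>i + 1\<close>, and exponents rise
  with them.\<close>

lemma Pi_prod_eq:
  assumes "0 < m"
  shows "Pi_prod q m K \<alpha> i = (\<Prod>j<m. \<alpha> (cyc m (i + 1 + int j)) ^ ((q ^ K) ^ j))"
proof -
  have "(\<Prod>j<m. \<alpha> (cyc m (i + 1 + int j)) ^ ((q ^ K) ^ j))
      = (\<Prod>j<m. \<alpha> (cyc m (i + 1 + int (m - Suc j))) ^ ((q ^ K) ^ (m - Suc j)))"
    by (rule prod.nat_diff_reindex[symmetric])
  also have "\<dots> = (\<Prod>j<m. \<alpha> (cyc m (i - int j)) ^ (q ^ ((m - 1 - j) * K)))"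
  proof (rule prod.cong[OF refl])
    fix j assume "j \<in> {..<m}"
    then have "i + 1 + int (m - Suc j) = (i - int j) + int m" by (simp add: of_nat_diff)
    then show "\<alpha> (cyc m (i + 1 + int (m - Suc j))) ^ ((q ^ K) ^ (m - Suc j))
        = \<alpha> (cyc m (i - int j)) ^ (q ^ ((m - 1 - j) * K))"
      by (simp only: cyc_add_modulus) (simp add: power_mult[symmetric] mult.commute)
  qed
  also have "\<dots> = Pi_prod q m K \<alpha> i"
    unfolding Pi_prod_def using assms by (intro prod.cong) auto
  finally show ?thesis by simp
qed

text \<open>The left side is the coefficient product of one turn around the recursion, starting at
  \<open>\<alpha> 2\<close>. Its later factors form the \<open>q ^ K\<close>-th power of the
  numerator \<open>X\<close> of \<open>K_const\<close>, and
  \<open>C_num q K m = 1 + q ^ K * C_num q K (m - 1)\<close> collects the powers of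
  \<open>\<alpha> 2\<close>.\<close>

lemma K_const_power:
  assumes "2 \<le> q" "0 < K" "3 \<le> m" "\<alpha> 2 \<noteq> (0 :: 'a :: field)"
  shows "(\<Prod>j<m. \<alpha> (cyc m (2 + int j)) ^ ((q ^ K) ^ j))
    = K_const q m K \<alpha> ^ (q ^ K) * \<alpha> 2 ^ C_num q K m"
proof -
  let ?N = "q ^ K"
  define k where "k = m - 2"
  then have k: "m = Suc (Suc k)" using assms(3) by simp
  have last: "cyc m (2 + int (Suc k)) = 1"
    using cyc_add_modulus[of m 1] cyc_eq[of 1 m] k by (simp add: add.commute)
  have mid: "cyc m (2 + int (Suc j)) = j + 3" if "j < k" for j
    using cyc_eq[of "j + 3" m] k that by (simp add: add.commute)
  have first: "cyc m 2 = 2" using cyc_eq[of 2 m] assms(3) by simp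
  have C: "C_num q K m = Suc (?N * C_num q K (m - 1))"
    using assms by (simp add: C_num_eq_sum k sum.lessThan_Suc_shift sum_distrib_left del: sum.lessThan_Suc)
  have P: "(\<Prod>i = 3..m. \<alpha> i ^ (q ^ ((i - 3) * K))) = (\<Prod>j<k. \<alpha> (j + 3) ^ (?N ^ j))"
    by (rule prod.reindex_bij_witness[of _ "\<lambda>j. j + 3" "\<lambda>i. i - 3"])
       (auto simp: k power_mult[symmetric] mult.commute)
  define X where "X = (\<Prod>j<k. \<alpha> (j + 3) ^ (?N ^ j)) * \<alpha> 1 ^ (?N ^ k)"
  have Kc: "K_const q m K \<alpha> * \<alpha> 2 ^ C_num q K (m - 1) = X"
    unfolding K_const_def P X_def using assms(4) 
    by (simp add: k power_mult[symmetric] mult.commute)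
  have "(\<Prod>j<m. \<alpha> (cyc m (2 + int j)) ^ (?N ^ j))
      = \<alpha> 2 * (\<Prod>j<Suc k. \<alpha> (cyc m (2 + int (Suc j))) ^ (?N ^ Suc j))"
    unfolding k prod.lessThan_Suc_shift using first k by simp
  also have "(\<Prod>j<Suc k. \<alpha> (cyc m (2 + int (Suc j))) ^ (?N ^ Suc j)) = X ^ ?N"
    unfolding prod.lessThan_Suc last using mid
    by (simp add: X_def power_mult_distrib prod_power_distrib power_mult[symmetric] mult.commute)
  also have "\<alpha> 2 * X ^ ?N = K_const q m K \<alpha> ^ ?N * \<alpha> 2 ^ C_num q K m"
    unfolding Kc[symmetric] C by (simp add: power_mult_distrib power_mult[symmetric] mult.commute mult.left_commute)
  finally show ?thesis .
qed

text \<open>Writing the successor with \<open>cyc\<close> absorbs the exceptional last index, so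
  that later arguments treat all rows alike.\<close>

lemma f_poly_cyc:
  assumes "i \<in> {1..m}"
  shows "f_poly q m I J \<alpha> i x = x i ^ (q ^ I) + \<alpha> (cyc m (int i + 1)) * x (cyc m (int i + 1)) ^ (q ^ J)"
proof (cases "i < m")
  case True
  then have "cyc m (int i + 1) = i + 1" using cyc_eq[of "i + 1" m] assms by (simp add: add.commute)
  then show ?thesis using True by (simp add: f_poly_def)
next
  case False
  then have [simp]: "i = m" using assms by simp
  have "cyc m (int i + 1) = 1"
    using cyc_add_modulus[of m 1] cyc_eq[of 1 m] assms by (simp add: add.commute)
  then show ?thesis by (simp add: f_poly_def)
qed

section \<open>Closure of the finite fields under the operations in use\<close>

lemma GF_mult: "x \<in> carrier (GF Q) \<Longrightarrow> y \<in> carrier (GF Q) \<Longrightarrow> x * y \<in> carrier (GF Q)"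
  by (simp add: carrier_GF_iff power_mult_distrib)

lemma GF_one: "1 \<in> carrier (GF Q)"
  by (simp add: carrier_GF_iff)

lemma GF_power: "x \<in> carrier (GF Q) \<Longrightarrow> x ^ k \<in> carrier (GF Q)"
  by (induction k) (simp_all add: GF_mult GF_one)

lemma GF_divide: "x \<in> carrier (GF Q) \<Longrightarrow> y \<in> carrier (GF Q) \<Longrightarrow> x / y \<in> carrier (GF Q)"
  by (simp add: carrier_GF_iff power_divide)

lemma GF_prod: "(\<And>i. i \<in> S \<Longrightarrow> f i \<in> carrier (GF Q)) \<Longrightarrow> prod f S \<in> carrier (GF Q)"
  by (simp add: carrier_GF_iff prod_power_distrib)

lemma GF_zero: "0 < Q \<Longrightarrow> 0 \<in> carrier (GF Q)"
  by (simp add: carrier_GF_iff)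

lemma GF_add:
  assumes "prime CHAR('a :: field)" "Q = CHAR('a) ^ s"
    and "(x :: 'a) \<in> carrier (GF Q)" "y \<in> carrier (GF Q)"
  shows "x + y \<in> carrier (GF Q)"
  using assms by (simp add: carrier_GF_iff freshmans_dream')

lemma GF_uminus:
  assumes "prime CHAR('a :: field)" "Q = CHAR('a) ^ s" and x: "(x :: 'a) \<in> carrier (GF Q)"
  shows "- x \<in> carrier (GF Q)"
proof -
  have "0 < Q" using assms(1,2) by (simp add: prime_gt_0_nat)
  have "((- x) + x) ^ Q = (- x) ^ Q + x ^ Q"
    unfolding assms(2) by (rule freshmans_dream'[OF assms(1) refl])
  then have "(- x) ^ Q + x = 0"
    using x zero_power[OF \<open>0 < Q\<close>, where 'a = 'a] by (simp add: carrier_GF_iff)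
  then show ?thesis by (simp add: carrier_GF_iff eq_neg_iff_add_eq_0)
qed

lemma GF_diff:
  assumes "prime CHAR('a :: field)" "Q = CHAR('a) ^ s"
    and "(x :: 'a) \<in> carrier (GF Q)" "y \<in> carrier (GF Q)"
  shows "x - y \<in> carrier (GF Q)"
  using GF_add[OF assms(1-3) GF_uminus[OF assms(1,2,4)]] by simp

lemma Pi_prod_in_GF:
  assumes "0 < m" "\<forall>i\<in>{1..m}. \<alpha> i \<in> carrier (GF Q) \<and> \<alpha> i \<noteq> (0 :: 'a :: field)"
  shows "Pi_prod q m K \<alpha> i \<in> carrier (GF Q)" "Pi_prod q m K \<alpha> i \<noteq> 0"
proof -
  show "Pi_prod q m K \<alpha> i \<in> carrier (GF Q)"
    unfolding Pi_prod_def using assms cyc_in by (intro GF_prod GF_power) blast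
  have "\<alpha> (cyc m j) \<noteq> 0" for j using assms cyc_in by blast
  then show "Pi_prod q m K \<alpha> i \<noteq> 0" unfolding Pi_prod_def by simp
qed

lemma K_const_in_GF:
  assumes "3 \<le> m" "\<forall>i\<in>{1..m}. \<alpha> i \<in> carrier (GF Q) \<and> \<alpha> i \<noteq> (0 :: 'a :: field)"
  shows "K_const q m K \<alpha> \<in> carrier (GF Q)" "K_const q m K \<alpha> \<noteq> 0"
proof -
  show "K_const q m K \<alpha> \<in> carrier (GF Q)"
    unfolding K_const_def using assms by (intro GF_prod GF_power GF_divide GF_mult) auto
  show "K_const q m K \<alpha> \<noteq> 0"
    unfolding K_const_def using assms by auto
qed

text \<open>The \<open>q ^ K\<close>-Frobenius is an automorphism of \<open>GF (q ^ e)\<close> whose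
  inverse is the \<open>q ^ (K * (e - 1))\<close>-power, and automorphisms map \<open>d\<close>-th
  powers to \<open>d\<close>-th powers.\<close>

lemma is_power_in_of_Frobenius:
  fixes a :: "'a :: field"
  assumes "is_power_in d (carrier (GF (q ^ e))) (a ^ (q ^ K))" "a \<in> carrier (GF (q ^ e))" "0 < e"
  shows "is_power_in d (carrier (GF (q ^ e))) a"
proof -
  obtain y where y: "y \<in> carrier (GF (q ^ e))" "a ^ (q ^ K) = y ^ d"
    using assms(1) by (auto simp: is_power_in_def)
  have e: "K * e = K + K * (e - 1)" using assms(3) by (cases e) auto
  have "a = a ^ ((q ^ e) ^ K)"
    using assms(2) by (simp add: carrier_GF_iff power_eq_iterate)
  also have "(q ^ e) ^ K = q ^ K * q ^ (K * (e - 1))"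
    by (metis e mult.commute power_add power_mult)
  also have "a ^ \<dots> = (y ^ (q ^ (K * (e - 1)))) ^ d"
    by (simp add: power_mult y(2)) (simp add: power_mult[symmetric] mult.commute)
  finally show ?thesis
    unfolding is_power_in_def using y(1) by (intro bexI[of _ "y ^ (q ^ (K * (e - 1)))"] GF_power) auto
qed

subsection \<open>Eigenvectors\<close>

text \<open>Comparing \<open>f (l x)\<close> with \<open>l f x\<close> leaves a two-term relation
  between cyclically adjacent entries. Since \<open>l\<close> is outside \<open>GF q\<close>, a
  nonzero entry makes both coefficients nonzero, and one turn around the resulting recursion makes
  \<open>K_const\<close> a \<open>C_num\<close>-th power.\<close>

lemma eigenvector_of_f_poly_eq_0:
  fixes \<alpha> x :: "nat \<Rightarrow> 'a :: field" and l :: 'a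
  assumes char: "prime CHAR('a)" and q: "q = CHAR('a) ^ r" "0 < r" and "0 < e"
    and IJ: "0 < I" "I < J" "gcd I J = 1" and m: "3 \<le> m"
    and \<alpha>: "\<forall>i\<in>{1..m}. \<alpha> i \<in> carrier (GF (q ^ e)) \<and> \<alpha> i \<noteq> 0"
    and x: "\<forall>i\<in>{1..m}. x i \<in> carrier (GF (q ^ e))"
    and l: "l \<in> carrier (GF (q ^ e))" "l \<notin> carrier (GF q)"
    and eigen: "\<forall>i\<in>{1..m}. f_poly q m I J \<alpha> i (\<lambda>j. l * x j) = l * f_poly q m I J \<alpha> i x"
    and npow: "\<not> is_power_in (C_num q (J - I) m) (carrier (GF (q ^ e))) (K_const q m (J - I) \<alpha>)"
    and i: "i \<in> {1..m}"
  shows "x i = 0"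
proof (rule ccontr)
  assume nz: "x i \<noteq> 0"
  define N where "N = q ^ (J - I)"
  have q2: "2 \<le> q"
    using char q by (metis Suc_1 Suc_leI one_less_power prime_gt_1_nat)
  have Q: "q ^ e = CHAR('a) ^ (r * e)" by (simp add: q power_mult)
  have m0: "0 < m" using m by simp
  have J: "q ^ J = q ^ I * N" using IJ by (simp add: N_def power_add[symmetric])
  define a b where "a = l ^ (q ^ I) - l" and "b = l ^ (q ^ J) - l"
  have rel: "a * x j ^ (q ^ I) + b * \<alpha> (cyc m (int j + 1)) * x (cyc m (int j + 1)) ^ (q ^ J) = 0"
    if "j \<in> {1..m}" for j
    using eigen[rule_format, OF that] unfolding f_poly_cyc[OF that]
    by (simp add: a_def b_def power_mult_distrib algebra_simps)
  have pred: "\<exists>j\<in>{1..m}. cyc m (int j + 1) = i"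
    using i m0 by (intro bexI[of _ "cyc m (int i - 1)"] cyc_in) (simp_all add: cyc_add_cyc cyc_eq)
  have "\<not> (a = 0 \<and> b = 0)"
    using GF_eq_of_coprime[OF IJ(1,3)] l(2) by (auto simp: a_def b_def carrier_GF_iff)
  \<comment> \<open>If \<open>a = 0\<close>, the relation of the predecessor of \<open>i\<close>,
    which contains \<open>x i\<close> in its second term, forces \<open>b = 0\<close>. The next step
    uses the relation of \<open>i\<close> itself, with \<open>x i\<close> in the first term.\<close>
  moreover have "a \<noteq> 0 \<or> b = 0"
    using pred rel nz \<alpha> i by fastforce
  moreover have "b \<noteq> 0 \<or> a = 0"
    using rel[OF i] nz by auto
  ultimately have ab: "a \<noteq> 0" "b \<noteq> 0" by auto
  define c where "c = - b / a"
  \<comment> \<open>Taking \<open>q ^ I\<close>-th powers turns the exponents \<open>q ^ I\<close>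
    and \<open>q ^ J\<close> into \<open>1\<close> and \<open>N\<close>. The start at entry 1 makes
    \<open>\<alpha> 2\<close> the first coefficient, as in \<open>K_const_power\<close>.\<close>
  define z where "z k = x (cyc m (1 + int k)) ^ (q ^ I)" for k
  have c: "c \<noteq> 0" "c \<in> carrier (GF (q ^ e))"
    using ab l by (auto simp: c_def a_def b_def intro!: GF_divide GF_uminus[OF char Q] GF_diff[OF char Q] GF_power)
  have \<alpha>cyc: "\<alpha> (cyc m k) \<noteq> 0" for k using \<alpha> cyc_in[OF m0] by blast
  have z_rec: "z k = (c * \<alpha> (cyc m (2 + int k))) * z (Suc k) ^ N" for k
  proof -
    have "cyc m (int (cyc m (1 + int k)) + 1) = cyc m (2 + int k)"
      by (simp add: cyc_add_cyc[OF m0])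
    then have "a * z k + b * \<alpha> (cyc m (2 + int k)) * z (Suc k) ^ N = 0"
      using rel[OF cyc_in[OF m0], of "1 + int k"]
      by (simp add: z_def J power_mult add.commute)
    then have "a * z k = - (b * \<alpha> (cyc m (2 + int k)) * z (Suc k) ^ N)"
      by (simp add: eq_neg_iff_add_eq_0)
    then show ?thesis using ab(1) by (simp add: c_def field_simps)
  qed
  have "z k = 0" if "z 0 = 0" for k
    using z_rec by (rule power_recursion_eq_0) (use c(1) \<alpha>cyc that in auto)
  moreover have "z (i - 1) \<noteq> 0"
    using nz i by (simp add: z_def of_nat_diff cyc_eq)
  ultimately have z0: "z 0 \<noteq> 0" by blast
  have zm: "z m = z 0"
    by (simp add: z_def cyc_add_modulus)
  let ?C = "C_num q (J - I) m" and ?K = "K_const q m (J - I) \<alpha>"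
  have Csum: "?C = (\<Sum>j<m. N ^ j)"
    using C_num_eq_sum[OF q2] IJ by (simp add: N_def)
  \<comment> \<open>After cancelling one factor \<open>z 0\<close>, the remaining exponent
    \<open>N ^ m - 1\<close> is a multiple of \<open>?C\<close>, so everything except
    \<open>?K ^ N\<close> is a \<open>?C\<close>-th power.\<close>
  have Nm: "N ^ m = Suc ((N - 1) * ?C)"
    using geometric_sum_nat[of N m] q2 by (simp add: Csum N_def)
  have "z 0 = (\<Prod>j<m. (c * \<alpha> (cyc m (2 + int j))) ^ (N ^ j)) * z 0 ^ (N ^ m)"
    using power_recursion_unroll[of z "\<lambda>j. c * \<alpha> (cyc m (2 + int j))", OF z_rec, of m] zm by simp
  also have "(\<Prod>j<m. (c * \<alpha> (cyc m (2 + int j))) ^ (N ^ j))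
      = c ^ ?C * (?K ^ N * \<alpha> 2 ^ ?C)"
    unfolding N_def using K_const_power[OF q2 _ m, of "J - I" \<alpha>] IJ \<alpha> m
    by (simp add: power_mult_distrib prod.distrib Csum N_def power_sum)
  finally have "?K ^ N * (c * \<alpha> 2 * z 0 ^ (N - 1)) ^ ?C = 1"
    using z0 unfolding Nm by (simp add: power_mult_distrib power_mult mult_ac)
  then have "?K ^ N = (1 / (c * \<alpha> 2 * z 0 ^ (N - 1))) ^ ?C"
    using z0 c(1) \<alpha> m by (simp add: power_divide field_simps)
  moreover have "z 0 \<in> carrier (GF (q ^ e))"
    using x cyc_in[OF m0] unfolding z_def by (intro GF_power) blast
  then have "1 / (c * \<alpha> 2 * z 0 ^ (N - 1)) \<in> carrier (GF (q ^ e))"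
    using \<alpha> m c by (intro GF_divide GF_mult GF_one GF_power) auto
  ultimately have "is_power_in ?C (carrier (GF (q ^ e))) (?K ^ N)"
    unfolding is_power_in_def by blast
  then have "is_power_in ?C (carrier (GF (q ^ e))) ?K"
    unfolding N_def by (rule is_power_in_of_Frobenius[OF _ K_const_in_GF(1)[OF m \<alpha>] \<open>0 < e\<close>])
  with npow show False by simp
qed

subsection \<open>Linear maps preserving the graph\<close>

text \<open>A polynomial of degree below \<open>Q\<close> vanishing on all \<open>Q\<close> elements
  of \<open>GF Q\<close> is zero. The exponent \<open>q ^ (2 * J)\<close> stands alone, but
  \<open>J = 2 * I\<close> would merge the terms of \<open>c2\<close> and \<open>c3\<close>; hence
  the lower coefficients are read off only once \<open>c3\<close> and \<open>c4\<close>
  vanish.\<close>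

lemma linearized_coeffs_eq_0:
  fixes c0 c1 c2 c3 c4 c5 :: "'a :: alg_closed_field"
  assumes char: "prime CHAR('a)" and Q: "Q = CHAR('a) ^ s" "0 < s"
    and q: "2 \<le> q" and IJ: "0 < I" "I < J" and deg: "q ^ (2 * J) < Q"
    and vanish: "\<forall>t\<in>carrier (GF Q). c0 * t + c1 * t ^ (q ^ I) + c2 * t ^ (q ^ J)
      + c3 * t ^ (q ^ (2 * I)) + c4 * t ^ (q ^ (I + J)) + c5 * t ^ (q ^ (2 * J)) = 0"
  shows "c5 = 0" and "c3 = 0 \<Longrightarrow> c4 = 0 \<Longrightarrow> c0 = 0 \<and> c1 = 0 \<and> c2 = 0"
proof -
  define P where "P = monom c0 (q ^ 0) + monom c1 (q ^ I) + monom c2 (q ^ J)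
      + monom c3 (q ^ (2 * I)) + monom c4 (q ^ (I + J)) + monom c5 (q ^ (2 * J))"
  have bound: "degree (monom c (q ^ k)) \<le> q ^ (2 * J)" if "k \<le> 2 * J" for c :: 'a and k
    using degree_monom_le[of c "q ^ k"] power_increasing[OF that, of q] q by linarith
  have degP: "degree P \<le> q ^ (2 * J)"
    unfolding P_def using IJ by (intro degree_add_le bound) auto
  have P0: "P = 0"
  proof (rule ccontr)
    assume "P \<noteq> 0"
    have "carrier (GF Q) \<subseteq> {t. poly P t = 0}"
      using vanish by (auto simp: P_def poly_monom)
    then have "card (carrier (GF Q :: 'a ring)) \<le> degree P"
      using card_poly_roots_bound[OF \<open>P \<noteq> 0\<close>] poly_roots_finite[OF \<open>P \<noteq> 0\<close>]
      by (meson card_mono order_trans)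
    then show False using card_GF[OF char Q] degP deg by simp
  qed
  have inj: "q ^ i = q ^ j \<longleftrightarrow> i = j" for i j
    using q by (intro power_inject_exp) simp
  have "coeff P (q ^ (2 * J)) = 0" "coeff P (q ^ 0) = 0" "coeff P (q ^ I) = 0" "coeff P (q ^ J) = 0"
    using P0 by simp_all
  then show "c5 = 0" "c3 = 0 \<Longrightarrow> c4 = 0 \<Longrightarrow> c0 = 0 \<and> c1 = 0 \<and> c2 = 0"
    unfolding P_def coeff_add coeff_monom inj using IJ by auto
qed

text \<open>The hypothesis \<open>pres\<close> says that the block matrix maps
  \<open>(x, f x)\<close> into the graph of \<open>f\<close> when \<open>x\<close> has the single
  entry \<open>t\<close> in position \<open>j\<close>; then \<open>f x\<close> has
  \<open>t ^ (q ^ I)\<close> at \<open>j\<close> and \<open>\<alpha> j * t ^ (q ^ J)\<close> at the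
  predecessor of \<open>j\<close>. The top coefficient in \<open>t\<close> kills \<open>B\<close>,
  and the lower ones then give the other claims.\<close>

lemma f_poly_preserving_blocks:
  fixes \<alpha> :: "nat \<Rightarrow> 'a :: alg_closed_field" and A B C D :: "nat \<Rightarrow> nat \<Rightarrow> 'a"
  assumes char: "prime CHAR('a)" and q: "q = CHAR('a) ^ r" "0 < r"
    and IJ: "0 < I" "I < J" "2 * J < e" and m: "0 < m"
    and \<alpha>: "\<forall>i\<in>{1..m}. \<alpha> i \<noteq> 0"
    and pres: "\<And>t i j. t \<in> carrier (GF (q ^ e)) \<Longrightarrow> i \<in> {1..m} \<Longrightarrow> j \<in> {1..m} \<Longrightarrow>
      f_poly q m I J \<alpha> i (\<lambda>k. A k j * t + B k j * t ^ (q ^ I) + B k (cyc m (int j - 1)) * \<alpha> j * t ^ (q ^ J))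
      = C i j * t + D i j * t ^ (q ^ I) + D i (cyc m (int j - 1)) * \<alpha> j * t ^ (q ^ J)"
    and i: "i \<in> {1..m}" and j: "j \<in> {1..m}"
  shows "B i j = 0" "C i j = 0" "D i j = A i j ^ (q ^ I)"
    "A i (cyc m (int j - 1)) ^ (q ^ I) * \<alpha> j
      = \<alpha> (cyc m (int i + 1)) * A (cyc m (int i + 1)) j ^ (q ^ J)"
proof -
  have q2: "2 \<le> q"
    using char q by (metis Suc_1 Suc_leI one_less_power prime_gt_1_nat)
  have Q: "q ^ e = CHAR('a) ^ (r * e)" "0 < r * e" using q IJ by (simp_all add: power_mult)
  have lt: "q ^ (2 * J) < q ^ e" using q2 IJ by (intro power_strict_increasing) auto
  have frob: "(x + y) ^ (q ^ k) = x ^ (q ^ k) + y ^ (q ^ k)" for x y :: 'a and k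
    using freshmans_dream'[OF char, of "q ^ k" "r * k"] by (simp add: q power_mult)
  have pow: "(t ^ (q ^ k)) ^ (q ^ k') = t ^ (q ^ (k + k'))" for t :: 'a and k k'
    by (simp add: power_mult[symmetric] power_add)
  \<comment> \<open>These are the coefficients of the difference of the two sides of
    \<open>pres\<close>, with \<open>s\<close> the successor of the row and \<open>j'\<close> the
    predecessor of the column.\<close>
  have van: "\<forall>t\<in>carrier (GF (q ^ e)).
        (- C i j) * t + (A i j ^ (q ^ I) - D i j) * t ^ (q ^ I)
      + (\<alpha> s * A s j ^ (q ^ J) - D i j' * \<alpha> j) * t ^ (q ^ J)
      + B i j ^ (q ^ I) * t ^ (q ^ (2 * I))
      + ((B i j' * \<alpha> j) ^ (q ^ I) + \<alpha> s * B s j ^ (q ^ J)) * t ^ (q ^ (I + J))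
      + (\<alpha> s * (B s j' * \<alpha> j) ^ (q ^ J)) * t ^ (q ^ (2 * J)) = 0"
    if i: "i \<in> {1..m}" and j: "j \<in> {1..m}" and s: "s = cyc m (int i + 1)" and j': "j' = cyc m (int j - 1)"
    for i j s j'
  proof
    fix t :: 'a assume "t \<in> carrier (GF (q ^ e))"
    from pres[OF this i j] show "(- C i j) * t + (A i j ^ (q ^ I) - D i j) * t ^ (q ^ I)
      + (\<alpha> s * A s j ^ (q ^ J) - D i j' * \<alpha> j) * t ^ (q ^ J)
      + B i j ^ (q ^ I) * t ^ (q ^ (2 * I))
      + ((B i j' * \<alpha> j) ^ (q ^ I) + \<alpha> s * B s j ^ (q ^ J)) * t ^ (q ^ (I + J))
      + (\<alpha> s * (B s j' * \<alpha> j) ^ (q ^ J)) * t ^ (q ^ (2 * J)) = 0"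
      unfolding f_poly_cyc[OF i] s[symmetric] j'[symmetric] frob power_mult_distrib pow mult_2
      by (simp add: algebra_simps)
  qed
  have B0: "B i j = 0" if i: "i \<in> {1..m}" and j: "j \<in> {1..m}" for i j
  proof -
    \<comment> \<open>\<open>B i j\<close> occurs in the top coefficient for the row before
      \<open>i\<close> and the column after \<open>j\<close>.\<close>
    have ij: "cyc m (int (cyc m (int i - 1)) + 1) = i" "cyc m (int (cyc m (int j + 1)) - 1) = j"
      unfolding cyc_succ_cyc[OF m] cyc_pred_cyc[OF m] using i j by (simp_all add: cyc_eq)
    have "\<alpha> i * (B i j * \<alpha> (cyc m (int j + 1))) ^ (q ^ J) = 0"
      using linearized_coeffs_eq_0(1)[OF char Q q2 IJ(1,2) lt
        van[OF cyc_in[OF m] cyc_in[OF m] ij(1)[symmetric] ij(2)[symmetric]]] .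
    moreover have "\<alpha> (cyc m (int j + 1)) \<noteq> 0" using \<alpha> cyc_in[OF m] by blast
    ultimately show ?thesis using \<alpha> i by simp
  qed
  show "B i j = 0" using B0 i j .
  have pow0: "(0 :: 'a) ^ (q ^ k) = 0" for k using q2 by (intro zero_power) simp
  have rest: "- C i j = 0 \<and> A i j ^ (q ^ I) - D i j = 0
      \<and> \<alpha> (cyc m (int i + 1)) * A (cyc m (int i + 1)) j ^ (q ^ J) - D i (cyc m (int j - 1)) * \<alpha> j = 0"
    if "i \<in> {1..m}" "j \<in> {1..m}" for i j
    using linearized_coeffs_eq_0(2)[OF char Q q2 IJ(1,2) lt van[OF that refl refl]]
      B0[OF that] B0[OF that(1) cyc_in[OF m]] B0[OF cyc_in[OF m] that(2)] by (simp add: pow0)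
  show "C i j = 0" "D i j = A i j ^ (q ^ I)" using rest[OF i j] by simp_all
  have "D i (cyc m (int j - 1)) = A i (cyc m (int j - 1)) ^ (q ^ I)"
    using rest[OF i cyc_in[OF m]] by simp
  then show "A i (cyc m (int j - 1)) ^ (q ^ I) * \<alpha> j
      = \<alpha> (cyc m (int i + 1)) * A (cyc m (int i + 1)) j ^ (q ^ J)"
    using rest[OF i j] by simp
qed

text \<open>The recursion moves one step down and one step right, so it stays on a cyclic diagonal
  and returns after \<open>m\<close> steps. If an entry is nonzero, one turn writes the quotient of
  the two \<open>Pi_prod\<close> values as the power of \<open>z 0\<close> with exponent
  \<open>N ^ m - 1\<close>.\<close>

lemma commuting_matrix_off_diagonal_eq_0:
  fixes \<alpha> :: "nat \<Rightarrow> 'a :: field" and a :: "nat \<Rightarrow> nat \<Rightarrow> 'a"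
  assumes q: "2 \<le> q" and m: "2 \<le> m"
    and \<alpha>: "\<forall>i\<in>{1..m}. \<alpha> i \<noteq> 0"
    and a: "\<And>i j. i \<in> {1..m} \<Longrightarrow> j \<in> {1..m} \<Longrightarrow> a i j \<in> carrier (GF Q)"
    and rec: "\<And>i j. i \<in> {1..m} \<Longrightarrow> j \<in> {1..m} \<Longrightarrow>
      a i (cyc m (int j - 1)) * \<alpha> j = \<alpha> (cyc m (int i + 1)) * a (cyc m (int i + 1)) j ^ (q ^ K)"
    and npow: "\<forall>\<delta>\<in>{1..m - 1}. \<not> is_power_in (q ^ (m * K) - 1) (carrier (GF Q))
           (Pi_prod q m K \<alpha> (int \<delta> + 2) / Pi_prod q m K \<alpha> 2)"
    and ij: "i \<in> {1..m}" "j \<in> {1..m}" "i \<noteq> j"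
  shows "a i j = 0"
proof (rule ccontr)
  assume nz: "a i j \<noteq> 0"
  have m0: "0 < m" using m by simp
  define N where "N = q ^ K"
  \<comment> \<open>\<open>\<delta>\<close> names the cyclic diagonal through \<open>(i, j)\<close>;
    it is nonzero because the entry is off the main diagonal.\<close>
  define \<delta> where "\<delta> = nat ((int j - int i) mod int m)"
  have \<delta>': "int \<delta> = (int j - int i) mod int m" using m0 by (simp add: \<delta>_def)
  have "\<delta> < m" using m0 by (simp add: \<delta>_def nat_less_iff)
  moreover have "\<delta> \<noteq> 0"
  proof
    assume "\<delta> = 0"
    then have "(int j - int i) mod int m = 0" using \<delta>' by simp
    then have "int j mod int m = int i mod int m"
      by (simp add: mod_eq_dvd_iff mod_eq_0_iff_dvd)
    then have "cyc m (int j) = cyc m (int i)" by (simp add: cyc_cong[OF m0])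
    then show False using ij by (simp add: cyc_eq)
  qed
  ultimately have \<delta>: "\<delta> \<in> {1..m - 1}" by auto
  \<comment> \<open>Starting in row 2 gives the first coefficient
    \<open>\<alpha> 3 / \<alpha> (cyc m (int \<delta> + 3))\<close>, so numerators and denominators
    multiply up to \<open>Pi_prod\<close> at \<open>2\<close> and at
    \<open>int \<delta> + 2\<close>.\<close>
  define z where "z k = a (cyc m (2 + int k)) (cyc m (int \<delta> + 2 + int k))" for k
  define c where "c k = \<alpha> (cyc m (3 + int k)) / \<alpha> (cyc m (int \<delta> + 3 + int k))" for k
  have \<alpha>cyc: "\<alpha> (cyc m k) \<noteq> 0" for k using \<alpha> cyc_in[OF m0] by blast
  have z_rec: "z k = c k * z (Suc k) ^ N" for k
  proof -
    have "cyc m (int (cyc m (2 + int k)) + 1) = cyc m (3 + int k)"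
      "cyc m (int (cyc m (int \<delta> + 3 + int k)) - 1) = cyc m (int \<delta> + 2 + int k)"
      unfolding cyc_succ_cyc[OF m0] cyc_pred_cyc[OF m0] by (simp_all add: algebra_simps)
    then have "z k * \<alpha> (cyc m (int \<delta> + 3 + int k)) = \<alpha> (cyc m (3 + int k)) * z (Suc k) ^ N"
      using rec[OF cyc_in[OF m0] cyc_in[OF m0], of "2 + int k" "int \<delta> + 3 + int k"]
      by (simp add: z_def N_def add_ac)
    then show ?thesis using \<alpha>cyc by (simp add: c_def field_simps)
  qed
  have "z k = 0" if "z 0 = 0" for k
    using z_rec by (rule power_recursion_eq_0) (use \<alpha>cyc that in \<open>auto simp: c_def\<close>)
  \<comment> \<open>This term is \<open>a i j\<close>; the extra \<open>m\<close> keeps the index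
    from being truncated at \<open>i = 1\<close>.\<close>
  moreover have "z (i + m - 2) \<noteq> 0"
  proof -
    have e: "2 + int (i + m - 2) = int i + int m" "int \<delta> + 2 + int (i + m - 2) = int \<delta> + int i + int m"
      using m ij by auto
    have "(int \<delta> + int i) mod int m = int j mod int m"
      unfolding \<delta>' by (simp add: mod_add_left_eq)
    then have "cyc m (int \<delta> + int i) = j"
      using cyc_cong[OF m0] cyc_eq[OF ij(2)] by metis
    then show ?thesis unfolding z_def e cyc_add_modulus using nz ij by (simp add: cyc_eq)
  qed
  ultimately have z0: "z 0 \<noteq> 0" by blast
  have zm: "z m = z 0" by (simp add: z_def cyc_add_modulus)
  let ?P = "Pi_prod q m K \<alpha>"
  have P: "?P 2 \<noteq> 0" "?P (int \<delta> + 2) \<noteq> 0"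
    using \<alpha>cyc by (simp_all add: Pi_prod_def)
  have Nm: "N ^ m = Suc (q ^ (m * K) - 1)"
    using q by (simp add: N_def power_mult[symmetric] mult.commute)
  have "z 0 = (\<Prod>j<m. c j ^ (N ^ j)) * z 0 ^ (N ^ m)"
    using power_recursion_unroll[of z, OF z_rec, of m] zm by simp
  also have "(\<Prod>j<m. c j ^ (N ^ j)) = ?P 2 / ?P (int \<delta> + 2)"
    by (simp add: c_def Pi_prod_eq[OF m0] N_def power_divide prod_dividef add_ac)
  finally have "?P (int \<delta> + 2) / ?P 2 = z 0 ^ (q ^ (m * K) - 1)"
    using z0 P unfolding Nm by (simp add: field_simps)
  moreover have "z 0 \<in> carrier (GF Q)"
    unfolding z_def by (rule a[OF cyc_in[OF m0] cyc_in[OF m0]])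
  ultimately show False using npow \<delta> unfolding is_power_in_def by blast
qed

text \<open>Raising to the power \<open>N\<close> fixes \<open>0\<close> and \<open>1\<close>, so on
  the main diagonal the factors \<open>\<alpha>\<close> cancel and neighbouring entries
  agree.\<close>

lemma commuting_idempotent_diagonal_eq:
  fixes \<alpha> :: "nat \<Rightarrow> 'a :: field" and a :: "nat \<Rightarrow> nat \<Rightarrow> 'a"
  assumes N: "0 < N" and m: "0 < m"
    and \<alpha>: "\<forall>i\<in>{1..m}. \<alpha> i \<noteq> 0"
    and a: "\<And>i. i \<in> {1..m} \<Longrightarrow> a i i \<in> {0, 1}"
    and rec: "\<And>i j. i \<in> {1..m} \<Longrightarrow> j \<in> {1..m} \<Longrightarrow>
      a i (cyc m (int j - 1)) * \<alpha> j = \<alpha> (cyc m (int i + 1)) * a (cyc m (int i + 1)) j ^ N"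
    and i: "i \<in> {1..m}"
  shows "a i i = a 1 1"
proof -
  have step: "a (cyc m (int i + 1)) (cyc m (int i + 1)) = a i i" if i: "i \<in> {1..m}" for i
  proof -
    let ?s = "cyc m (int i + 1)"
    have s: "?s \<in> {1..m}" by (rule cyc_in[OF m])
    have "cyc m (int ?s - 1) = i"
      unfolding cyc_pred_cyc[OF m] using i by (simp add: cyc_eq)
    then have "a i i * \<alpha> ?s = \<alpha> ?s * a ?s ?s ^ N" using rec[OF i s] by simp
    moreover have "\<alpha> ?s \<noteq> 0" using \<alpha> s by blast
    moreover have "a ?s ?s ^ N = a ?s ?s" using a[OF s] N by auto
    ultimately show ?thesis by simp
  qed
  have "a (cyc m (1 + int k)) (cyc m (1 + int k)) = a (cyc m 1) (cyc m 1)" for k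
  proof (induction k)
    case (Suc k)
    then show ?case
      using step[OF cyc_in[OF m], of "1 + int k"] unfolding cyc_succ_cyc[OF m]
      by (simp add: add_ac)
  qed simp
  from this[of "i - 1"] show ?thesis
    using i m cyc_eq[of 1 m] by (simp add: of_nat_diff cyc_eq)
qed

subsection \<open>Subspaces of coordinate spaces\<close>

lemma GF_vec_simps:
  "carrier (GF_vec Q d) = {v \<in> carrier_vec d. \<forall>i<d. v $ i \<in> carrier (GF Q)}"
  "(\<oplus>\<^bsub>GF_vec Q d\<^esub>) = (+)" "\<zero>\<^bsub>GF_vec Q d\<^esub> = 0\<^sub>v d" "(\<odot>\<^bsub>GF_vec Q d\<^esub>) = (\<cdot>\<^sub>v)"
  by (simp_all add: GF_vec_def module_vec_simps)

lemma GF_vec_subspaceD: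
  assumes "subspace E W (GF_vec Q d)"
  shows "W \<subseteq> carrier (GF_vec Q d)" "0\<^sub>v d \<in> W"
    "v \<in> W \<Longrightarrow> w \<in> W \<Longrightarrow> v + w \<in> W" "c \<in> carrier E \<Longrightarrow> v \<in> W \<Longrightarrow> c \<cdot>\<^sub>v v \<in> W"
  using assms unfolding subspace_def LinearCombinations.submodule_def GF_vec_simps by auto

lemma subspaceI:
  assumes "vectorspace F V" "W \<subseteq> carrier V" "\<zero>\<^bsub>V\<^esub> \<in> W"
    and "\<And>v w. v \<in> W \<Longrightarrow> w \<in> W \<Longrightarrow> v \<oplus>\<^bsub>V\<^esub> w \<in> W"
    and "\<And>c v. c \<in> carrier F \<Longrightarrow> v \<in> W \<Longrightarrow> c \<odot>\<^bsub>V\<^esub> v \<in> W"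
  shows "subspace F W V"
  using assms unfolding subspace_def LinearCombinations.submodule_def vectorspace_def by blast

lemma (in Module.module) span_singleton:
  assumes "v \<in> carrier M"
  shows "LinearCombinations.module.span R M {v} = {c \<odot>\<^bsub>M\<^esub> v | c. c \<in> carrier R}"
proof -
  have m: "Module.module R M" by (rule module_axioms)
  have lc: "LinearCombinations.module.lincomb M a {v} = a v \<odot>\<^bsub>M\<^esub> v" if "a v \<in> carrier R" for a
    unfolding LinearCombinations.module.lincomb_def[OF m] using assms that by simp
  have "LinearCombinations.module.span R M {v}
      = {LinearCombinations.module.lincomb M a {v} | a. a \<in> {v} \<rightarrow> carrier R}"
    using assms by (intro LinearCombinations.module.finite_span[OF m]) auto
  also have "\<dots> = {c \<odot>\<^bsub>M\<^esub> v | c. c \<in> carrier R}"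
  proof (intro equalityI subsetI)
    fix u assume "u \<in> {c \<odot>\<^bsub>M\<^esub> v | c. c \<in> carrier R}"
    then obtain c where c: "u = c \<odot>\<^bsub>M\<^esub> v" "c \<in> carrier R" by blast
    then have "u = LinearCombinations.module.lincomb M (\<lambda>_. c) {v}" by (simp add: lc)
    then show "u \<in> {LinearCombinations.module.lincomb M a {v} | a. a \<in> {v} \<rightarrow> carrier R}"
      using c(2) by blast
  qed (use lc in auto)
  finally show ?thesis .
qed

lemma (in vectorspace) dim_le_1I:
  assumes W: "subspace K W V" and w: "w \<in> W"
    and gen: "\<And>u. u \<in> W \<Longrightarrow> \<exists>c\<in>carrier K. u = c \<odot>\<^bsub>V\<^esub> w"
  shows "vectorspace.dim K (V\<lparr>carrier := W\<rparr>) \<le> 1"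
proof -
  interpret W: vectorspace K "V\<lparr>carrier := W\<rparr>" by (rule subspace_is_vs[OF W])
  have "W.span {w} = W"
  proof -
    have "W.span {w} = {c \<odot>\<^bsub>V\<^esub> w | c. c \<in> carrier K}"
      using W.span_singleton[of w] w by simp
    also have "\<dots> = W"
      using W w gen unfolding subspace_def LinearCombinations.submodule_def by blast
    finally show ?thesis .
  qed
  then show ?thesis using W.gen_ge_dim[of "{w}"] w by simp
qed

lemma is_direct_sumD:
  assumes "Module.module R V" "is_direct_sum V W W1 W2"
  shows "u \<in> W \<Longrightarrow> \<exists>v\<in>W1. \<exists>w\<in>W2. u = v \<oplus>\<^bsub>V\<^esub> w" "W1 \<inter> W2 = {\<zero>\<^bsub>V\<^esub>}"
  using assms(2) unfolding is_direct_sum_def LinearCombinations.module.submodule_sum_def[OF assms(1)]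
  by auto

lemma subspace_lincomb:
  fixes n :: nat
  assumes "subspace E W (GF_vec Q d)" "\<And>k. k < n \<Longrightarrow> w k \<in> W" "\<And>k. k < n \<Longrightarrow> c k \<in> carrier E"
  shows "vec d (\<lambda>i. \<Sum>k<n. c k * w k $ i) \<in> W"
  using assms(2,3)
proof (induction n)
  case 0
  have "vec d (\<lambda>i. \<Sum>k<0. c k * w k $ i) = 0\<^sub>v d" by auto
  then show ?case using GF_vec_subspaceD(2)[OF assms(1)] by simp
next
  case (Suc n)
  have "w n \<in> carrier_vec d"
    using Suc.prems(1)[of n] GF_vec_subspaceD(1)[OF assms(1)] by (auto simp: GF_vec_simps)
  then have "vec d (\<lambda>i. \<Sum>k<Suc n. c k * w k $ i) = vec d (\<lambda>i. \<Sum>k<n. c k * w k $ i) + c n \<cdot>\<^sub>v w n"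
    by auto
  then show ?case using Suc GF_vec_subspaceD(3,4)[OF assms(1)] by simp
qed

lemma vec_eq_lincomb_unit:
  fixes v :: "'a :: semiring_1 vec"
  assumes "v \<in> carrier_vec d"
  shows "v = vec d (\<lambda>i. \<Sum>k<d. v $ k * unit_vec d k $ i)"
proof (rule eq_vecI)
  fix i assume "i < dim_vec (vec d (\<lambda>i. \<Sum>k<d. v $ k * unit_vec d k $ i))"
  then have i: "i < d" by simp
  have "(\<Sum>k<d. v $ k * unit_vec d k $ i) = (\<Sum>k<d. if k = i then v $ k else 0)"
    using i by (intro sum.cong) auto
  then show "v $ i = vec d (\<lambda>i. \<Sum>k<d. v $ k * unit_vec d k $ i) $ i" using i by simp
qed (use assms in auto)

lemma subspace_unit_vecs_imp_eq_carrier: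
  fixes W :: "'a :: field vec set"
  assumes "subspace (GF Q) W (GF_vec Q d)" "\<And>k. k < d \<Longrightarrow> unit_vec d k \<in> W"
  shows "W = carrier (GF_vec Q d)"
proof
  show "carrier (GF_vec Q d) \<subseteq> W"
  proof
    fix v :: "'a vec" assume "v \<in> carrier (GF_vec Q d)"
    then have v: "v \<in> carrier_vec d" "\<And>k. k < d \<Longrightarrow> v $ k \<in> carrier (GF Q)" by (auto simp: GF_vec_simps)
    show "v \<in> W"
      by (subst vec_eq_lincomb_unit[OF v(1)]) (rule subspace_lincomb[OF assms(1)], use assms(2) v(2) in auto)
  qed
qed (rule GF_vec_subspaceD(1)[OF assms(1)])

text \<open>The vectors \<open>w k\<close> are the columns of the projection onto \<open>W1\<close> along \<open>W2\<close>.\<close>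

lemma direct_sum_projection:
  fixes W1 W2 :: "'a :: field vec set"
  assumes char: "prime CHAR('a)" and Q: "Q = CHAR('a) ^ s"
    and W: "subspace (GF Q) W1 (GF_vec Q d)" "subspace (GF Q) W2 (GF_vec Q d)"
    and sum: "is_direct_sum (GF_vec Q d) (carrier (GF_vec Q d)) W1 W2"
  obtains w where "\<And>k. k < d \<Longrightarrow> w k \<in> W1" "\<And>k. k < d \<Longrightarrow> unit_vec d k - w k \<in> W2"
    "\<And>U u. U \<subseteq> carrier (GF_vec Q d) \<Longrightarrow> is_direct_sum (GF_vec Q d) U (U \<inter> W1) (U \<inter> W2) \<Longrightarrow>
      u \<in> U \<Longrightarrow> vec d (\<lambda>i. \<Sum>k<d. u $ k * w k $ i) \<in> U"
proof -
  have mod: "Module.module (GF Q) (GF_vec Q d :: ('a, 'a vec) module)"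
    using vectorspace_GF_vec[OF char Q, of 1 d] by (simp add: vectorspace_def)
  have Q0: "0 < Q" using char Q by (simp add: prime_gt_0_nat)
  have vecW: "v \<in> carrier_vec d" if "v \<in> W1 \<union> W2" for v
    using that GF_vec_subspaceD(1)[OF W(1)] GF_vec_subspaceD(1)[OF W(2)] by (auto simp: GF_vec_simps)
  have "unit_vec d k \<in> carrier (GF_vec Q d)" if "k < d" for k
    using that Q0 by (auto simp: GF_vec_simps GF_zero GF_one)
  then have "\<forall>k<d. \<exists>v\<in>W1. \<exists>w\<in>W2. unit_vec d k = v + w"
    using is_direct_sumD(1)[OF mod sum] unfolding GF_vec_simps(2) by blast
  then obtain w w' where w: "\<And>k. k < d \<Longrightarrow> w k \<in> W1 \<and> w' k \<in> W2 \<and> unit_vec d k = w k + w' k"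
    by metis
  have w': "unit_vec d k - w k = w' k" if "k < d" for k
  proof -
    have "w k \<in> carrier_vec d" "w' k \<in> carrier_vec d" "unit_vec d k = w k + w' k"
      using w[OF that] vecW by auto
    then show ?thesis by (intro eq_vecI) auto
  qed
  show thesis
  proof (rule that[of w])
    fix U u
    assume U: "U \<subseteq> carrier (GF_vec Q d)" "is_direct_sum (GF_vec Q d) U (U \<inter> W1) (U \<inter> W2)" "u \<in> U"
    \<comment> \<open>The decomposition of \<open>U\<close> provides a component \<open>u1\<close>
      that lies in \<open>U\<close>; it remains to identify it with the image \<open>p\<close> of
      \<open>u\<close>.\<close>
    obtain u1 u2 where u: "u1 \<in> U" "u1 \<in> W1" "u2 \<in> W2" "u = u1 + u2"
      using is_direct_sumD(1)[OF mod U(2,3)] by (auto simp: GF_vec_simps)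
    have uk: "u \<in> carrier_vec d" "\<And>k. k < d \<Longrightarrow> u $ k \<in> carrier (GF Q)"
      using U(1,3) by (auto simp: GF_vec_simps)
    define p p' where "p = vec d (\<lambda>i. \<Sum>k<d. u $ k * w k $ i)"
      and "p' = vec d (\<lambda>i. \<Sum>k<d. u $ k * w' k $ i)"
    have p: "p \<in> W1" "p' \<in> W2"
      unfolding p_def p'_def
      by (rule subspace_lincomb[OF W(1)], use w uk in auto) (rule subspace_lincomb[OF W(2)], use w uk in auto)
    have up: "u $ i = p $ i + p' $ i" if i: "i < d" for i
    proof -
      have "u $ i = (\<Sum>k<d. u $ k * unit_vec d k $ i)"
        using arg_cong[OF vec_eq_lincomb_unit[OF uk(1)], of "\<lambda>v. v $ i"] i by simp
      also have "\<dots> = (\<Sum>k<d. u $ k * (w k $ i + w' k $ i))"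
      proof (rule sum.cong[OF refl])
        fix k assume "k \<in> {..<d}"
        then have "unit_vec d k $ i = (w k + w' k) $ i" "w' k \<in> carrier_vec d"
          using w[of k] vecW by auto
        then show "u $ k * unit_vec d k $ i = u $ k * (w k $ i + w' k $ i)" using i by simp
      qed
      finally show ?thesis using i by (simp add: p_def p'_def distrib_left sum.distrib)
    qed
    have m1: "- 1 \<in> carrier (GF Q :: 'a ring)" by (rule GF_uminus[OF char Q GF_one])
    have car: "u1 \<in> carrier_vec d" "u2 \<in> carrier_vec d" "p \<in> carrier_vec d" "p' \<in> carrier_vec d"
      using u p vecW by auto
    \<comment> \<open>Two decompositions of \<open>u\<close> are compared: the common difference
      lies in both \<open>W1\<close> and \<open>W2\<close>, hence is zero.\<close>
    have "u1 + (- 1) \<cdot>\<^sub>v p = p' + (- 1) \<cdot>\<^sub>v u2"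
    proof (rule eq_vecI)
      fix i assume "i < dim_vec (p' + (- 1) \<cdot>\<^sub>v u2)"
      then have i: "i < d" using car by auto
      then have "u1 $ i + u2 $ i = p $ i + p' $ i" using up[OF i] u(4) car by simp
      then show "(u1 + (- 1) \<cdot>\<^sub>v p) $ i = (p' + (- 1) \<cdot>\<^sub>v u2) $ i"
        using i car by (simp add: algebra_simps)
    qed (use car in auto)
    moreover have "u1 + (- 1) \<cdot>\<^sub>v p \<in> W1" "p' + (- 1) \<cdot>\<^sub>v u2 \<in> W2"
      using u p m1 GF_vec_subspaceD(3,4)[OF W(1)] GF_vec_subspaceD(3,4)[OF W(2)] by auto
    ultimately have z: "u1 + (- 1) \<cdot>\<^sub>v p = 0\<^sub>v d"
      using is_direct_sumD(2)[OF mod sum] by (auto simp: GF_vec_simps)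
    have "u1 = p"
    proof (rule eq_vecI)
      fix i assume "i < dim_vec p"
      then have i: "i < d" using car by auto
      then show "u1 $ i = p $ i" using arg_cong[OF z, of "\<lambda>v. v $ i"] car by simp
    qed (use car in auto)
    then show "vec d (\<lambda>i. \<Sum>k<d. u $ k * w k $ i) \<in> U" using u(1) by (simp add: p_def)
  qed (use w w' in auto)
qed

subsection \<open>Scatteredness and indecomposability\<close>

lemma f_poly_cong:
  assumes "\<And>j. j \<in> {1..m} \<Longrightarrow> x j = y j" "i \<in> {1..m}"
  shows "f_poly q m I J \<alpha> i x = f_poly q m I J \<alpha> i y"
proof -
  have "cyc m (int i + 1) \<in> {1..m}" using assms(2) by (intro cyc_in) auto
  then show ?thesis using assms by (simp add: f_poly_cyc)
qed

text \<open>The first \<open>m\<close> entries recover the parameter \<open>x\<close>, so membership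
  becomes a condition on entries; the shifts by one translate between families starting at 1 and
  entries starting at 0.\<close>

lemma U_set_iff:
  "v \<in> U_set q Q m I J \<alpha> \<longleftrightarrow> v \<in> carrier_vec (2 * m) \<and>
    (\<forall>i\<in>{1..m}. v $ (i - 1) \<in> carrier (GF Q) \<and>
       v $ (m + i - 1) = f_poly q m I J \<alpha> i (\<lambda>j. v $ (j - 1)))" (is "_ \<longleftrightarrow> ?R")
proof
  assume "v \<in> U_set q Q m I J \<alpha>"
  then obtain x where x: "v = vec (2 * m) (\<lambda>i. if i < m then x (i + 1) else f_poly q m I J \<alpha> (i - m + 1) x)"
    "\<forall>i\<in>{1..m}. x i \<in> carrier (GF Q)" unfolding U_set_def by blast
  have vx: "v $ (i - 1) = x i" if "i \<in> {1..m}" for i using that by (auto simp: x(1))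
  have "v $ (m + i - 1) = f_poly q m I J \<alpha> i (\<lambda>j. v $ (j - 1))" if i: "i \<in> {1..m}" for i
  proof -
    have "v $ (m + i - 1) = f_poly q m I J \<alpha> i x" using i by (auto simp: x(1))
    also have "\<dots> = f_poly q m I J \<alpha> i (\<lambda>j. v $ (j - 1))"
      using vx i by (intro f_poly_cong) auto
    finally show ?thesis .
  qed
  then show ?R using x vx by auto
next
  assume R: ?R
  have "v = vec (2 * m) (\<lambda>i. if i < m then v $ (i + 1 - 1) else f_poly q m I J \<alpha> (i - m + 1) (\<lambda>j. v $ (j - 1)))"
  proof (rule eq_vecI)
    fix i assume "i < dim_vec (vec (2 * m) (\<lambda>i. if i < m then v $ (i + 1 - 1)
      else f_poly q m I J \<alpha> (i - m + 1) (\<lambda>j. v $ (j - 1))))"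
    then have i: "i < 2 * m" by simp
    then show "v $ i = vec (2 * m) (\<lambda>i. if i < m then v $ (i + 1 - 1)
      else f_poly q m I J \<alpha> (i - m + 1) (\<lambda>j. v $ (j - 1))) $ i"
    proof (cases "i < m")
      case False
      then have "i - m + 1 \<in> {1..m}" "m + (i - m + 1) - 1 = i" using i by auto
      then have "v $ i = f_poly q m I J \<alpha> (i - m + 1) (\<lambda>j. v $ (j - 1))"
        using R by metis
      then show ?thesis using False i by simp
    qed simp
  qed (use R in auto)
  then show "v \<in> U_set q Q m I J \<alpha>"
    unfolding U_set_def using R by (intro CollectI exI[of _ "\<lambda>j. v $ (j - 1)"]) auto
qed

lemma U_set_subset_carrier:
  fixes \<alpha> :: "nat \<Rightarrow> 'a :: field"
  assumes char: "prime CHAR('a)" and Q: "Q = CHAR('a) ^ s" and m: "0 < m"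
    and \<alpha>: "\<forall>i\<in>{1..m}. \<alpha> i \<in> carrier (GF Q)"
  shows "U_set q Q m I J \<alpha> \<subseteq> carrier (GF_vec Q (2 * m))"
proof
  fix v assume v: "v \<in> U_set q Q m I J \<alpha>"
  have low: "v $ (i - 1) \<in> carrier (GF Q)" if "i \<in> {1..m}" for i
    using v that by (simp add: U_set_iff)
  have "v $ (m + i - 1) \<in> carrier (GF Q)" if i: "i \<in> {1..m}" for i
  proof -
    have "f_poly q m I J \<alpha> i (\<lambda>j. v $ (j - 1)) \<in> carrier (GF Q)"
      unfolding f_poly_cyc[OF i] using i \<alpha> cyc_in[OF m]
      by (intro GF_add[OF char Q] GF_mult GF_power low) blast+
    then show ?thesis using v i by (simp add: U_set_iff)
  qed
  note high = this
  have "v $ k \<in> carrier (GF Q)" if "k < 2 * m" for k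
  proof (cases "k < m")
    case True then show ?thesis using low[of "k + 1"] by simp
  next
    case False then show ?thesis using high[of "k - m + 1"] that by simp
  qed
  then show "v \<in> carrier (GF_vec Q (2 * m))" using v by (simp add: GF_vec_simps U_set_iff)
qed

text \<open>Powers with exponent \<open>q ^ k\<close> are additive and fix \<open>GF q\<close>, so
  each \<open>f\<close> is linear over \<open>GF q\<close>.\<close>

lemma subspace_U_set:
  fixes \<alpha> :: "nat \<Rightarrow> 'a :: field"
  assumes char: "prime CHAR('a)" and q: "q = CHAR('a) ^ r" and m: "0 < m"
    and \<alpha>: "\<forall>i\<in>{1..m}. \<alpha> i \<in> carrier (GF (q ^ e))"
  shows "subspace (GF q) (U_set q (q ^ e) m I J \<alpha>) (GF_vec (q ^ e) (2 * m))"
proof -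
  have Q: "q ^ e = CHAR('a) ^ (r * e)" by (simp add: q power_mult)
  have q0: "0 < q" using char q by (simp add: prime_gt_0_nat)
  have frob: "(x + y) ^ (q ^ k) = x ^ (q ^ k) + y ^ (q ^ k)" for x y :: 'a and k
    using freshmans_dream'[OF char, of "q ^ k" "r * k"] by (simp add: q power_mult)
  have pow0: "(0 :: 'a) ^ (q ^ k) = 0" for k using q0 by (intro zero_power) simp
  have cyc: "cyc m k - 1 < 2 * m" "cyc m k - 1 < m" for k using cyc_in[OF m, of k] by auto
  show ?thesis
  proof (rule subspaceI)
    show "vectorspace (GF q) (GF_vec (q ^ e) (2 * m) :: ('a, 'a vec) module)"
      by (rule vectorspace_GF_vec[OF char q])
    show "U_set q (q ^ e) m I J \<alpha> \<subseteq> carrier (GF_vec (q ^ e) (2 * m))"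
      by (rule U_set_subset_carrier[OF char Q m \<alpha>])
    show "\<zero>\<^bsub>GF_vec (q ^ e) (2 * m)\<^esub> \<in> U_set q (q ^ e) m I J \<alpha>"
      using q0 cyc by (auto simp: U_set_iff GF_vec_simps f_poly_cyc pow0 GF_zero)
  next
    fix v w assume vw: "v \<in> U_set q (q ^ e) m I J \<alpha>" "w \<in> U_set q (q ^ e) m I J \<alpha>"
    then have "v \<in> carrier_vec (2 * m)" "w \<in> carrier_vec (2 * m)" by (auto simp: U_set_iff)
    then show "v \<oplus>\<^bsub>GF_vec (q ^ e) (2 * m)\<^esub> w \<in> U_set q (q ^ e) m I J \<alpha>"
      using vw cyc by (auto simp: U_set_iff GF_vec_simps f_poly_cyc frob algebra_simps intro!: GF_add[OF char Q])
  next
    fix c :: 'a and v assume c: "c \<in> carrier (GF q)" and v: "v \<in> U_set q (q ^ e) m I J \<alpha>"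
    then have "v \<in> carrier_vec (2 * m)" by (auto simp: U_set_iff)
    moreover have "c \<in> carrier (GF (q ^ e))" "c ^ (q ^ k) = c" for k
      using c power_eq_iterate[of c q] by (simp_all add: carrier_GF_iff)
    ultimately show "c \<odot>\<^bsub>GF_vec (q ^ e) (2 * m)\<^esub> v \<in> U_set q (q ^ e) m I J \<alpha>"
      using v cyc by (auto simp: U_set_iff GF_vec_simps f_poly_cyc power_mult_distrib algebra_simps intro!: GF_mult)
  qed
qed

text \<open>Two elements of \<open>U\<close> on one line, the first nonzero, differ by a scalar
  \<open>l\<close>. Were \<open>l\<close> outside \<open>GF q\<close>, the first half of the nonzero
  vector would vanish by \<open>eigenvector_of_f_poly_eq_0\<close>, and with it the whole
  vector.\<close>

lemma scattered_U_set:
  fixes \<alpha> :: "nat \<Rightarrow> 'a :: field"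
  assumes char: "prime CHAR('a)" and q: "q = CHAR('a) ^ r" "0 < r" and e: "0 < e"
    and IJ: "0 < I" "I < J" "gcd I J = 1" and m: "3 \<le> m"
    and \<alpha>: "\<forall>i\<in>{1..m}. \<alpha> i \<in> carrier (GF (q ^ e)) \<and> \<alpha> i \<noteq> 0"
    and npow: "\<not> is_power_in (C_num q (J - I) m) (carrier (GF (q ^ e))) (K_const q m (J - I) \<alpha>)"
  shows "scattered (GF q) (GF (q ^ e)) (GF_vec (q ^ e) (2 * m)) (U_set q (q ^ e) m I J \<alpha>)"
proof -
  let ?V = "GF_vec (q ^ e) (2 * m) :: ('a, 'a vec) module" and ?U = "U_set q (q ^ e) m I J \<alpha>"
  have Q: "q ^ e = CHAR('a) ^ (r * e)" by (simp add: q power_mult)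
  have q0: "0 < q" using char q by (simp add: prime_gt_0_nat)
  have U: "subspace (GF q) ?U ?V" using subspace_U_set[OF char q(1)] m \<alpha> by simp
  interpret F: vectorspace "GF q" ?V by (rule vectorspace_GF_vec[OF char q(1)])
  interpret E: vectorspace "GF (q ^ e)" ?V using vectorspace_GF_vec[OF char Q, of 1] by simp
  show ?thesis unfolding scattered_def
  proof (intro conjI ballI U)
    fix v assume v: "v \<in> carrier ?V"
    define W where "W = ?U \<inter> E.span {v}"
    have span: "E.span {v} = {c \<cdot>\<^sub>v v | c. c \<in> carrier (GF (q ^ e))}"
      using E.span_singleton[OF v] by (simp add: GF_vec_simps)
    have vd: "v \<in> carrier_vec (2 * m)" using v by (simp add: GF_vec_simps)
    have incl: "c \<in> carrier (GF (q ^ e))" if "c \<in> carrier (GF q)" for c :: 'a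
      using GF_mono[OF char q(1) that] .
    have Wsub: "subspace (GF q) W ?V"
    proof (rule subspaceI[OF F.vectorspace_axioms])
      show "W \<subseteq> carrier ?V" using GF_vec_subspaceD(1)[OF U] by (auto simp: W_def)
      have "0\<^sub>v (2 * m) = 0 \<cdot>\<^sub>v v" using vd by auto
      moreover have "(0 :: 'a) \<in> carrier (GF (q ^ e))" using q0 by (simp add: GF_zero)
      ultimately show "\<zero>\<^bsub>?V\<^esub> \<in> W" using GF_vec_subspaceD(2)[OF U] unfolding W_def span GF_vec_simps by blast
    next
      fix a b assume ab: "a \<in> W" "b \<in> W"
      then obtain c d where cd: "a = c \<cdot>\<^sub>v v" "b = d \<cdot>\<^sub>v v" "c \<in> carrier (GF (q ^ e))" "d \<in> carrier (GF (q ^ e))"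
        unfolding W_def span by blast
      have "a + b = (c + d) \<cdot>\<^sub>v v" by (simp add: cd add_smult_distrib_vec)
      moreover have "c + d \<in> carrier (GF (q ^ e))" using GF_add[OF char Q] cd by blast
      ultimately show "a \<oplus>\<^bsub>?V\<^esub> b \<in> W"
        using ab GF_vec_subspaceD(3)[OF U, of a b] unfolding W_def span GF_vec_simps by blast
    next
      fix c :: 'a and a assume ca: "c \<in> carrier (GF q)" "a \<in> W"
      then obtain d where d: "a = d \<cdot>\<^sub>v v" "d \<in> carrier (GF (q ^ e))"
        unfolding W_def span by blast
      have "c \<cdot>\<^sub>v a = (c * d) \<cdot>\<^sub>v v" by (simp add: d smult_smult_assoc)
      moreover have "c * d \<in> carrier (GF (q ^ e))" using incl ca d by (intro GF_mult) auto
      ultimately show "c \<odot>\<^bsub>?V\<^esub> a \<in> W"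
        using ca GF_vec_subspaceD(4)[OF U, of c a] unfolding W_def span GF_vec_simps by blast
    qed
    obtain w where w: "w \<in> W" "\<And>u. u \<in> W \<Longrightarrow> \<exists>c\<in>carrier (GF q). u = c \<odot>\<^bsub>?V\<^esub> w"
    proof (cases "W = {0\<^sub>v (2 * m)}")
      case True
      \<comment> \<open>\<open>dim_le_1I\<close> allows a zero generator, which covers the trivial
        intersection.\<close>
      have "0\<^sub>v (2 * m) = 1 \<cdot>\<^sub>v (0\<^sub>v (2 * m) :: 'a vec)" by auto
      then show thesis using True
        by (intro that[of "0\<^sub>v (2 * m)"] bexI[of _ 1]) (auto simp: GF_vec_simps intro: GF_one)
    next
      case False
      then obtain w where w: "w \<in> W" "w \<noteq> 0\<^sub>v (2 * m)" using GF_vec_subspaceD(2)[OF Wsub] by blast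
      then obtain c where c: "w = c \<cdot>\<^sub>v v" "c \<in> carrier (GF (q ^ e))" unfolding W_def span by blast
      have wU: "w \<in> ?U" and wd: "w \<in> carrier_vec (2 * m)" using w by (simp_all add: W_def U_set_iff)
      have c0: "c \<noteq> 0" using w(2) c(1) vd by auto
      show thesis
      proof (rule that[OF w(1)])
        fix u assume u: "u \<in> W"
        then obtain d where d: "u = d \<cdot>\<^sub>v v" "d \<in> carrier (GF (q ^ e))" unfolding W_def span by blast
        define l where "l = d / c"
        have l: "l \<in> carrier (GF (q ^ e))" using c d by (simp add: l_def GF_divide)
        have ul: "u = l \<cdot>\<^sub>v w" using c0 by (simp add: l_def c(1) d(1) smult_smult_assoc)
        have uU: "u \<in> ?U" using u by (simp add: W_def)
        have "l \<in> carrier (GF q)"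
        proof (rule ccontr)
          assume nl: "l \<notin> carrier (GF q)"
          define x where "x = (\<lambda>j. w $ (j - 1))"
          have x: "\<forall>i\<in>{1..m}. x i \<in> carrier (GF (q ^ e))" using wU by (simp add: x_def U_set_iff)
          have wf: "w $ (m + i - 1) = f_poly q m I J \<alpha> i x" if "i \<in> {1..m}" for i
            using wU that by (simp add: x_def U_set_iff)
          have eigen: "\<forall>i\<in>{1..m}. f_poly q m I J \<alpha> i (\<lambda>j. l * x j) = l * f_poly q m I J \<alpha> i x"
          proof
            fix i assume i: "i \<in> {1..m}"
            have "f_poly q m I J \<alpha> i (\<lambda>j. l * x j) = f_poly q m I J \<alpha> i (\<lambda>j. u $ (j - 1))"
              using wd i by (intro f_poly_cong) (auto simp: ul x_def)
            also have "\<dots> = u $ (m + i - 1)" using uU i by (simp add: U_set_iff)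
            also have "\<dots> = l * f_poly q m I J \<alpha> i x" using wf[OF i] wd i by (auto simp: ul)
            finally show "f_poly q m I J \<alpha> i (\<lambda>j. l * x j) = l * f_poly q m I J \<alpha> i x" .
          qed
          have x0: "x i = 0" if "i \<in> {1..m}" for i
            by (rule eigenvector_of_f_poly_eq_0[OF char q e IJ m \<alpha> x l nl eigen npow that])
          have "w $ k = 0" if k: "k < 2 * m" for k
          proof (cases "k < m")
            case True then show ?thesis using x0[of "k + 1"] by (simp add: x_def)
          next
            case False
            then have i: "k - m + 1 \<in> {1..m}" "m + (k - m + 1) - 1 = k" using k by auto
            have "w $ k = f_poly q m I J \<alpha> (k - m + 1) x" using wf[OF i(1)] i(2) by simp
            also have "\<dots> = f_poly q m I J \<alpha> (k - m + 1) (\<lambda>_. 0)"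
              using x0 i(1) by (intro f_poly_cong) auto
            also have "\<dots> = 0" using q0 by (simp add: f_poly_def zero_power)
            finally show ?thesis .
          qed
          then have "w = 0\<^sub>v (2 * m)" using wd by (intro eq_vecI) auto
          then show False using w(2) by simp
        qed
        then show "\<exists>c\<in>carrier (GF q). u = c \<odot>\<^bsub>?V\<^esub> w" using ul by (auto simp: GF_vec_simps)
      qed
    qed
    show "vectorspace.dim (GF q) (?V\<lparr>carrier := ?U \<inter> E.span {v}\<rparr>) \<le> 1"
      using F.dim_le_1I[OF Wsub w] by (simp add: W_def)
  qed
qed

section \<open>Indecomposability through the projection attached to a decomposition\<close>

lemma sum_halves:
  "(\<Sum>k<2 * m. g k) = (\<Sum>j = 1..m. g (j - 1)) + (\<Sum>j = 1..m. g (m + j - 1 :: nat) :: 'a :: comm_monoid_add)"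
proof -
  have shift: "(\<Sum>j = 1..m. h (j - 1)) = (\<Sum>k<m. h k)" for h :: "nat \<Rightarrow> 'a"
    by (rule sum.reindex_bij_witness[of _ Suc "\<lambda>j. j - 1"]) auto
  have "(\<Sum>k<2 * m. g k) = (\<Sum>k<m. g k) + (\<Sum>k<m. g (m + k))"
    using sum.atLeastLessThan_shift_0[of g m "2 * m"] sum.atLeastLessThan_concat[of 0 m "2 * m" g]
    by (simp add: lessThan_atLeast0 add.commute)
  also have "(\<Sum>k<m. g (m + k)) = (\<Sum>j = 1..m. g (m + (j - 1)))" by (rule shift[symmetric])
  also have "\<dots> = (\<Sum>j = 1..m. g (m + j - 1))" by (intro sum.cong) auto
  finally show ?thesis by (simp only: shift)
qed

text \<open>The bound \<open>2 * J < e\<close> keeps the linearized polynomials below degree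
  \<open>q ^ e\<close>, so coefficients can be compared; \<open>npow\<close> then removes the
  off-diagonal entries of the projection. What is left is zero or the identity, which makes
  \<open>W1\<close> or \<open>W2\<close> trivial.\<close>

lemma indecomposable_U_set:
  fixes \<alpha> :: "nat \<Rightarrow> 'a :: alg_closed_field"
  assumes char: "prime CHAR('a)" and q: "q = CHAR('a) ^ r" "0 < r"
    and IJ: "0 < I" "I < J" "2 * J < e" and m: "2 \<le> m"
    and \<alpha>: "\<forall>i\<in>{1..m}. \<alpha> i \<in> carrier (GF (q ^ e)) \<and> \<alpha> i \<noteq> 0"
    and npow: "\<forall>\<delta>\<in>{1..m - 1}. \<not> is_power_in (q ^ (m * (J - I)) - 1) (carrier (GF (q ^ e)))
           (Pi_prod q m (J - I) \<alpha> (int \<delta> + 2) / Pi_prod q m (J - I) \<alpha> 2)"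
  shows "indecomposable (GF (q ^ e)) (GF_vec (q ^ e) (2 * m)) (U_set q (q ^ e) m I J \<alpha>)"
proof
  let ?E = "GF (q ^ e) :: 'a ring" and ?V = "GF_vec (q ^ e) (2 * m) :: ('a, 'a vec) module"
    and ?U = "U_set q (q ^ e) m I J \<alpha>"
  assume "decomposable ?E ?V ?U"
  then obtain W1 W2 where W: "subspace ?E W1 ?V" "subspace ?E W2 ?V" and
    Wne: "W1 \<noteq> {0\<^sub>v (2 * m)}" "W2 \<noteq> {0\<^sub>v (2 * m)}" and
    dV: "is_direct_sum ?V (carrier ?V) W1 W2" and dU: "is_direct_sum ?V ?U (?U \<inter> W1) (?U \<inter> W2)"
    unfolding decomposable_def GF_vec_simps(3) by blast
  have Q: "q ^ e = CHAR('a) ^ (r * e)" by (simp add: q power_mult)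
  have q2: "2 \<le> q" using char q by (metis Suc_1 Suc_leI one_less_power prime_gt_1_nat)
  have pow0: "(0 :: 'a) ^ (q ^ k) = 0" for k using q2 by (intro zero_power) simp
  have m0: "0 < m" using m by simp
  have \<alpha>0: "\<forall>i\<in>{1..m}. \<alpha> i \<noteq> 0" using \<alpha> by blast
  have Usub: "?U \<subseteq> carrier ?V" using \<alpha> by (intro U_set_subset_carrier[OF char Q m0]) blast
  obtain w where w1: "\<And>k. k < 2 * m \<Longrightarrow> w k \<in> W1" and w2: "\<And>k. k < 2 * m \<Longrightarrow> unit_vec (2 * m) k - w k \<in> W2"
    and wU: "\<And>u. u \<in> ?U \<Longrightarrow> vec (2 * m) (\<lambda>i. \<Sum>k<2 * m. u $ k * w k $ i) \<in> ?U"
  proof (rule direct_sum_projection[OF char Q W dV])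
    fix w
    assume "\<And>k. k < 2 * m \<Longrightarrow> w k \<in> W1" "\<And>k. k < 2 * m \<Longrightarrow> unit_vec (2 * m) k - w k \<in> W2"
      "\<And>U u. U \<subseteq> carrier ?V \<Longrightarrow> is_direct_sum ?V U (U \<inter> W1) (U \<inter> W2) \<Longrightarrow>
        u \<in> U \<Longrightarrow> vec (2 * m) (\<lambda>i. \<Sum>k<2 * m. u $ k * w k $ i) \<in> U"
    then show thesis using Usub dU by (intro that)
  qed
  have wV: "w k \<in> carrier_vec (2 * m)" "i < 2 * m \<Longrightarrow> w k $ i \<in> carrier ?E" if "k < 2 * m" for k i
    using w1[OF that] GF_vec_subspaceD(1)[OF W(1)] by (auto simp: GF_vec_simps)

  \<comment> \<open>The vectors \<open>w k\<close> are the columns of the projection; these are its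
    four blocks, with indices from 1.\<close>
  define A where "A i j = w (j - 1) $ (i - 1)" for i j
  define B where "B i j = w (m + j - 1) $ (i - 1)" for i j
  define C where "C i j = w (j - 1) $ (m + i - 1)" for i j
  define D where "D i j = w (m + j - 1) $ (m + i - 1)" for i j
  have pres: "f_poly q m I J \<alpha> i (\<lambda>k. A k j * t + B k j * t ^ (q ^ I) + B k (cyc m (int j - 1)) * \<alpha> j * t ^ (q ^ J))
      = C i j * t + D i j * t ^ (q ^ I) + D i (cyc m (int j - 1)) * \<alpha> j * t ^ (q ^ J)"
    if t: "t \<in> carrier ?E" and i: "i \<in> {1..m}" and j: "j \<in> {1..m}" for t i j
  proof -
    define j' where "j' = cyc m (int j - 1)"
    have j': "j' \<in> {1..m}" unfolding j'_def by (rule cyc_in[OF m0])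
    have succ_iff: "cyc m (int k + 1) = j \<longleftrightarrow> k = j'" if k: "k \<in> {1..m}" for k
    proof
      assume "cyc m (int k + 1) = j"
      then show "k = j'" unfolding j'_def using cyc_pred_cyc[OF m0, of "int k + 1"] cyc_eq[OF k] by simp
    next
      assume "k = j'"
      then show "cyc m (int k + 1) = j"
        unfolding j'_def using cyc_succ_cyc[OF m0, of "int j - 1"] cyc_eq[OF j] by simp
    qed
    \<comment> \<open>The test vectors \<open>(x, f x)\<close> have the single entry
      \<open>t\<close> of \<open>x\<close> at position \<open>j\<close>; their images under the
      projection yield the hypothesis of \<open>f_poly_preserving_blocks\<close>.\<close>
    define x where "x k = (if k = j then t else 0)" for k :: nat
    define u where "u = vec (2 * m) (\<lambda>i. if i < m then x (i + 1) else f_poly q m I J \<alpha> (i - m + 1) x)"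
    have "0 \<in> carrier ?E" using q2 by (intro GF_zero) simp
    then have "u \<in> ?U" unfolding U_set_def u_def using t
      by (intro CollectI exI[of _ x]) (auto simp: x_def)
    from wU[OF this] have pU: "vec (2 * m) (\<lambda>i. \<Sum>k<2 * m. u $ k * w k $ i) \<in> ?U" (is "?p \<in> _") .
    have ulow: "u $ (k - 1) = (if k = j then t else 0)" if "k \<in> {1..m}" for k
      using that by (auto simp: u_def x_def)
    have uhigh: "u $ (m + k - 1) = (if k = j then t ^ (q ^ I) else 0) + (if k = j' then \<alpha> j * t ^ (q ^ J) else 0)"
      if k: "k \<in> {1..m}" for k
    proof -
      have "u $ (m + k - 1) = f_poly q m I J \<alpha> k x" using k by (auto simp: u_def)
      also have "\<dots> = (if k = j then t ^ (q ^ I) else 0) + (if k = j' then \<alpha> j * t ^ (q ^ J) else 0)"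
        unfolding f_poly_cyc[OF k] x_def succ_iff[OF k] using succ_iff[OF k] by (auto simp: pow0)
      finally show ?thesis .
    qed
    have p: "?p $ i = w (j - 1) $ i * t + w (m + j - 1) $ i * t ^ (q ^ I) + w (m + j' - 1) $ i * \<alpha> j * t ^ (q ^ J)"
      if "i < 2 * m" for i
    proof -
      have "?p $ i = (\<Sum>k = 1..m. u $ (k - 1) * w (k - 1) $ i) + (\<Sum>k = 1..m. u $ (m + k - 1) * w (m + k - 1) $ i)"
        using that by (simp add: sum_halves)
      also have "(\<Sum>k = 1..m. u $ (k - 1) * w (k - 1) $ i) = (\<Sum>k = 1..m. if k = j then t * w (k - 1) $ i else 0)"
        by (intro sum.cong refl) (subst ulow, auto)
      also have "\<dots> = t * w (j - 1) $ i" using j by simp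
      also have "(\<Sum>k = 1..m. u $ (m + k - 1) * w (m + k - 1) $ i)
        = (\<Sum>k = 1..m. if k = j then t ^ (q ^ I) * w (m + k - 1) $ i else 0)
          + (\<Sum>k = 1..m. if k = j' then \<alpha> j * t ^ (q ^ J) * w (m + k - 1) $ i else 0)"
        unfolding sum.distrib[symmetric] by (intro sum.cong refl) (subst uhigh, auto simp: distrib_right)
      also have "\<dots> = t ^ (q ^ I) * w (m + j - 1) $ i + \<alpha> j * t ^ (q ^ J) * w (m + j' - 1) $ i"
        using j j' by simp
      finally show ?thesis by (simp add: mult_ac add_ac)
    qed
    have "?p $ (m + i - 1) = f_poly q m I J \<alpha> i (\<lambda>k. ?p $ (k - 1))"
      using pU i unfolding U_set_iff by blast
    also have "\<dots> = f_poly q m I J \<alpha> i (\<lambda>k. A k j * t + B k j * t ^ (q ^ I) + B k j' * \<alpha> j * t ^ (q ^ J))"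
      using i by (intro f_poly_cong) (subst p, auto simp: A_def B_def)
    finally show ?thesis
      using i unfolding j'_def[symmetric] C_def D_def by (subst (asm) p) auto
  qed
  note blocks = f_poly_preserving_blocks[OF char q IJ m0 \<alpha>0 pres]
  have B0: "B i j = 0" and C0: "C i j = 0" and DA: "D i j = A i j ^ (q ^ I)"
    if "i \<in> {1..m}" "j \<in> {1..m}" for i j
    using blocks(1-3)[OF _ _ _ that] by auto
  have J: "q ^ J = q ^ I * q ^ (J - I)" using IJ by (simp add: power_add[symmetric])
  \<comment> \<open>Since \<open>D\<close> is the entrywise \<open>q ^ I\<close>-th power of
    \<open>A\<close>, the relation between \<open>A\<close>-entries becomes a recursion in
    \<open>D\<close> alone, with exponent \<open>q ^ (J - I)\<close>.\<close>
  have rec: "D i (cyc m (int j - 1)) * \<alpha> j = \<alpha> (cyc m (int i + 1)) * D (cyc m (int i + 1)) j ^ (q ^ (J - I))"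
    if "i \<in> {1..m}" "j \<in> {1..m}" for i j
    using blocks(4)[OF _ _ _ that] that unfolding DA[OF that(1) cyc_in[OF m0]] DA[OF cyc_in[OF m0] that(2)]
    by (simp add: J power_mult)
  have DGF: "D i j \<in> carrier ?E" if "i \<in> {1..m}" "j \<in> {1..m}" for i j
    unfolding D_def using that by (intro wV(2)) auto
  have D0: "D i j = 0" if "i \<in> {1..m}" "j \<in> {1..m}" "i \<noteq> j" for i j
    using commuting_matrix_off_diagonal_eq_0[OF q2 m \<alpha>0 DGF rec npow that] .
  have A0: "A i j = 0" if "i \<in> {1..m}" "j \<in> {1..m}" "i \<noteq> j" for i j
    using D0[OF that] DA[OF that(1,2)] by simp

  have idx: "(\<exists>i\<in>{1..m}. k = i - 1) \<or> (\<exists>i\<in>{1..m}. k = m + i - 1)" if "k < 2 * m" for k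
  proof (cases "k < m")
    case True then show ?thesis by (intro disjI1 bexI[of _ "k + 1"]) auto
  next
    case False then show ?thesis using that by (intro disjI2 bexI[of _ "k - m + 1"]) auto
  qed
  have off: "w k $ i = 0" if "k < 2 * m" "i < 2 * m" "i \<noteq> k" for i k
    using idx[OF that(1)]
  proof (elim disjE bexE)
    fix j assume j: "j \<in> {1..m}" "k = j - 1"
    from idx[OF that(2)] show ?thesis
      by (elim disjE bexE) (use A0[OF _ j(1)] C0[OF _ j(1)] j(2) that(3) in \<open>auto simp: A_def C_def\<close>)
  next
    fix j assume j: "j \<in> {1..m}" "k = m + j - 1"
    from idx[OF that(2)] show ?thesis
      by (elim disjE bexE) (use B0[OF _ j(1)] D0[OF _ j(1)] j(2) that(3) in \<open>auto simp: B_def D_def\<close>)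
  qed
  have w_eq: "w k = w k $ k \<cdot>\<^sub>v unit_vec (2 * m) k" if "k < 2 * m" for k
    using off[OF that] wV(1)[OF that] that by (intro eq_vecI) auto
  have inter: "W1 \<inter> W2 = {0\<^sub>v (2 * m)}"
    using dV unfolding is_direct_sum_def GF_vec_simps(3) by blast
  \<comment> \<open>Column \<open>k\<close> is \<open>?c\<close> times a unit vector. Otherwise
    nonzero multiples of that unit vector would lie in \<open>W1\<close> and in \<open>W2\<close>,
    with scalars \<open>?c\<close> and \<open>1 - ?c\<close>.\<close>
  have diag01: "w k $ k \<in> {0, 1}" if k: "k < 2 * m" for k
  proof (rule ccontr)
    let ?c = "w k $ k" and ?e = "unit_vec (2 * m) k :: 'a vec"
    assume "?c \<notin> {0, 1}"
    then have c: "?c \<noteq> 0" "1 - ?c \<noteq> 0" by auto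
    have cE: "?c \<in> carrier ?E" "1 - ?c \<in> carrier ?E"
      using wV(2)[OF k k] GF_diff[OF char Q GF_one] by auto
    have "?e - w k = (1 - ?c) \<cdot>\<^sub>v ?e" by (subst w_eq[OF k]) (auto intro!: eq_vecI simp: left_diff_distrib)
    then have "(1 - ?c) \<cdot>\<^sub>v ?e \<in> W2" using w2[OF k] by simp
    from GF_vec_subspaceD(4)[OF W(2) GF_divide[OF GF_one cE(2)] this]
    have "(1 / (1 - ?c)) \<cdot>\<^sub>v ((1 - ?c) \<cdot>\<^sub>v ?e) \<in> W2" .
    moreover have "?c \<cdot>\<^sub>v ?e \<in> W1" using w1[OF k] w_eq[OF k] by simp
    from GF_vec_subspaceD(4)[OF W(1) GF_divide[OF GF_one cE(1)] this]
    have "(1 / ?c) \<cdot>\<^sub>v (?c \<cdot>\<^sub>v ?e) \<in> W1" .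
    ultimately have "?e \<in> W1 \<inter> W2" using c by (simp add: smult_smult_assoc)
    then have "?e = 0\<^sub>v (2 * m)" using inter by blast
    then have "?e $ k = 0\<^sub>v (2 * m) $ k" by simp
    then show False using k by simp
  qed
  have D01: "D i i \<in> {0, 1}" and A01: "A i i \<in> {0, 1}" if "i \<in> {1..m}" for i
    using diag01[of "m + i - 1"] diag01[of "i - 1"] that by (auto simp: D_def A_def)
  have DD: "D i i = D 1 1" if "i \<in> {1..m}" for i
    by (rule commuting_idempotent_diagonal_eq[OF _ m0 \<alpha>0 D01 rec that]) (use q2 in auto)
  \<comment> \<open>An entry in \<open>{0, 1}\<close> equals its own \<open>q ^ I\<close>-th power,
    so both diagonal blocks agree.\<close>
  have AD: "A i i = D i i" if "i \<in> {1..m}" for i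
    using A01[OF that] DA[OF that that] by (auto simp: pow0)
  have diag: "w k $ k = D 1 1" if "k < 2 * m" for k
    using idx[OF that] AD DD unfolding A_def D_def by auto
  have V: "W1 \<subseteq> carrier ?V" "W2 \<subseteq> carrier ?V" using W by (auto dest: GF_vec_subspaceD(1))
  have zero: "0\<^sub>v (2 * m) \<in> W1" "0\<^sub>v (2 * m) \<in> W2" using W by (auto dest: GF_vec_subspaceD(2))
  have "D 1 1 \<in> {0, 1}" using D01[of 1] m0 by simp
  then show False
  proof
    assume D: "D 1 1 = 0"
    have "unit_vec (2 * m) k \<in> W2" if k: "k < 2 * m" for k
    proof -
      have "w k = 0\<^sub>v (2 * m)" using w_eq[OF k] diag[OF k] D by auto
      moreover have "unit_vec (2 * m) k - 0\<^sub>v (2 * m) = (unit_vec (2 * m) k :: 'a vec)" by auto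
      ultimately show ?thesis using w2[OF k] by simp
    qed
    then have "W2 = carrier ?V" by (rule subspace_unit_vecs_imp_eq_carrier[OF W(2)])
    then show False using inter V(1) zero Wne(1) by blast
  next
    assume "D 1 1 \<in> {1}"
    then have D: "D 1 1 = 1" by simp
    have "unit_vec (2 * m) k \<in> W1" if k: "k < 2 * m" for k
    proof -
      have "w k = unit_vec (2 * m) k" using w_eq[OF k] diag[OF k] D by auto
      then show ?thesis using w1[OF k] by simp
    qed
    then have "W1 = carrier ?V" by (rule subspace_unit_vecs_imp_eq_carrier[OF W(1)])
    then show False using inter V(2) zero Wne(2) by blast
  qed
qed

section \<open>Transfer of the hypotheses to infinitely many extensions\<close>

theorem mainTheorem7:
  fixes p r q n m I J K :: nat and \<alpha> :: "nat \<Rightarrow> 'a :: alg_closed_field"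
  assumes "prime p" and "CHAR('a) = p" and "0 < r" and "q = p ^ r"
    and "0 < n" and "3 \<le> m"
    and "0 < I" and "I < J" and "J < n" and "K = J - I"
    and "\<forall>i\<in>{1..m}. \<alpha> i \<in> carrier (GF (q ^ n)) \<and> \<alpha> i \<noteq> 0"
    and "gcd I J = 1"
    and "\<not> is_power_in (C_num q K m) (carrier (GF (q ^ n))) (K_const q m K \<alpha>)"
    and "\<forall>\<delta>\<in>{1..m - 1}. \<not> is_power_in (q ^ (m * K) - 1) (carrier (GF (q ^ n)))
           (Pi_prod q m K \<alpha> (int \<delta> + 2) / Pi_prod q m K \<alpha> 2)"
  shows "infinite {l. 0 < l \<and>
           scattered (GF q) (GF (q ^ (n * l))) (GF_vec (q ^ (n * l)) (2 * m))
             (U_set q (q ^ (n * l)) m I J \<alpha>) \<and>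
           indecomposable (GF (q ^ (n * l))) (GF_vec (q ^ (n * l)) (2 * m))
             (U_set q (q ^ (n * l)) m I J \<alpha>)}" (is "infinite ?S")
proof -
  note \<alpha> = assms(11)
  have char: "prime CHAR('a)" and q: "q = CHAR('a) ^ r" "0 < r" using assms(1-4) by simp_all
  have q2: "2 \<le> q" using char q by (metis Suc_1 Suc_leI one_less_power prime_gt_1_nat)
  have K0: "0 < K" and m0: "0 < m" using assms by auto
  \<comment> \<open>\<open>C_num q K m\<close> divides \<open>d\<close>, so coprimality to this one
    number serves both non-power hypotheses.\<close>
  define d where "d = q ^ (m * K) - 1"
  have d0: "0 < d"
    using one_less_power[of q "m * K"] q2 K0 m0 by (simp add: d_def)
  have Cd: "C_num q K m dvd d"
    using geometric_sum_nat[of "q ^ K" m] C_num_eq_sum[OF q2 K0, of m]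
    unfolding d_def by (metis dvd_triv_right mult.commute power_mult)
  \<comment> \<open>\<open>Suc (d * t)\<close> is coprime to \<open>d\<close>, and
    \<open>0 < t\<close> makes it at least 2, which gives \<open>2 * J < n * ?l\<close> from
    \<open>J < n\<close>.\<close>
  have good: "Suc (d * t) \<in> ?S" if t: "0 < t" for t
  proof -
    let ?l = "Suc (d * t)"
    have cop: "coprime ?l d" by (metis coprime_Suc_left_nat coprime_mult_right_iff)
    then have copC: "coprime ?l (C_num q K m)" using Cd by (meson coprime_divisors dvd_refl)
    have e: "0 < n * ?l" using assms(5) by simp
    have "2 * n \<le> n * ?l" using d0 t by (cases "d * t") auto
    then have e2: "2 * J < n * ?l" using assms(9) by linarith
    have \<alpha>l: "\<forall>i\<in>{1..m}. \<alpha> i \<in> carrier (GF (q ^ (n * ?l))) \<and> \<alpha> i \<noteq> 0"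
      using \<alpha> power_eq_iterate[of _ "q ^ n" ?l] unfolding power_mult carrier_GF_iff by blast
    have nK: "\<not> is_power_in (C_num q K m) (carrier (GF (q ^ (n * ?l)))) (K_const q m K \<alpha>)"
      using GF_power_descent[OF K_const_in_GF[OF assms(6) \<alpha>] _ copC] assms(13) unfolding power_mult by blast
    have "\<not> is_power_in d (carrier (GF (q ^ (n * ?l)))) (Pi_prod q m K \<alpha> (int \<delta> + 2) / Pi_prod q m K \<alpha> 2)"
      if "\<delta> \<in> {1..m - 1}" for \<delta>
    proof -
      have "Pi_prod q m K \<alpha> (int \<delta> + 2) / Pi_prod q m K \<alpha> 2 \<in> carrier (GF (q ^ n))"
        "Pi_prod q m K \<alpha> (int \<delta> + 2) / Pi_prod q m K \<alpha> 2 \<noteq> 0"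
        using Pi_prod_in_GF[OF m0 \<alpha>] by (auto intro: GF_divide)
      from GF_power_descent[OF this _ cop] show ?thesis
        using assms(14) that unfolding d_def power_mult by blast
    qed
    then have "indecomposable (GF (q ^ (n * ?l))) (GF_vec (q ^ (n * ?l)) (2 * m)) (U_set q (q ^ (n * ?l)) m I J \<alpha>)"
      using indecomposable_U_set[OF char q assms(7,8) e2 _ \<alpha>l] assms(6,10) unfolding d_def by simp
    moreover have "scattered (GF q) (GF (q ^ (n * ?l))) (GF_vec (q ^ (n * ?l)) (2 * m)) (U_set q (q ^ (n * ?l)) m I J \<alpha>)"
      using scattered_U_set[OF char q e assms(7,8,12,6) \<alpha>l] nK assms(10) by simp
    ultimately show ?thesis by simp
  qed
  have "inj_on (\<lambda>t. Suc (d * t)) {0<..}" using d0 by (simp add: inj_on_def)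
  moreover have "infinite {0 :: nat <..}" by (rule infinite_Ioi)
  ultimately have "infinite ((\<lambda>t. Suc (d * t)) ` {0<..})" by (simp add: finite_image_iff)
  moreover have "(\<lambda>t. Suc (d * t)) ` {0<..} \<subseteq> ?S" using good by blast
  ultimately show ?thesis using finite_subset by blast
qed

end
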